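(* Let $\mathcal{A}\otimes\mathcal{C}$, $\epsilon$, the elements $O_A$, $O_{A_1,\dots,A_r}$ and the supercommutator $\llbracket\cdot,\cdot\rrbracket_-$ be as defined in the context. Let $A$ and $B$ be two lists of $\{1,\dots,N\}$ such that $A\cap B=\emptyset$ as sets. Then $$\llbracket O_A,O_B\rrbracket_-=\epsilon\sum_{a\in A}\llbracket O_a,O_{a,A,B}\rrbracket_-.$$
   Context: Let $\mathbb{K}$ be $\mathbb{R}$ or $\mathbb{C}$ and $N\ge1$. $\mathcal{A}$ is the unital associative $\mathbb{K}$-algebra generated by $x_1,\dots,x_N,p_1,\dots,p_N$ subject to the relations, for all $i,j$, $$[x_i,x_j]=0,\quad [p_i,p_j]=0,\quad \Big[\tfrac12\sum_{i=1}^N p_i^2,\,x_j\Big]=p_j,\quad \Big[\tfrac12\sum_{i=1}^N x_i^2,\,p_j\Big]=-x_j,$$ where $[a,b]=ab-ba$. Fix $\epsilon\in\{+1,-1\}$. $\mathcal{C}$ is the Clifford algebra over $\mathbb{K}$ generated by $e_1,\dots,e_N$ with $e_ie_j+e_je_i=2\epsilon\delta_{ij}$. In $\mathcal{A}\otimes\mathcal{C}$ the tensor sign is omitted, and the $e_i$ commute with all $x_j,p_j$. Put $\underline{D}=\sum_{i=1}^N e_ip_i$. A list is a finite (possibly empty) sequence $A=a_1\cdots a_n$ of distinct elements of $\{1,\dots,N\}$, $|A|=n$; $e_A=e_{a_1}\cdots e_{a_n}$, $e_\emptyset=1$. In set operations a list is viewed as its underlying set; $A\triangle B=(A\cup B)\setminus(A\cap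 B)$ is the symmetric difference. For a set (or list) $S\subset\{1,\dots,N\}$, $\underline{x}_S=\sum_{s\in S}x_se_s$. For lists $A_1,\dots,A_r$ ($r\ge1$), with $S=A_1\triangle\cdots\triangle A_r$ and $E=e_{A_1}\cdots e_{A_r}$, define $$O_{A_1,\dots,A_r}=\tfrac12\big(\underline{D}\,\underline{x}_S E-E\,\underline{x}_S\underline{D}-\epsilon E\big);$$ in particular $O_A$ is the case $r=1$, and $O_a$ is the case of the one-element list $a$. The set $S$ is called the index set of $O_{A_1,\dots,A_r}$. For two such operators $X,Y$ with index sets $S,T$, the supercommutators are $$\llbracket X,Y\rrbracket_\mp=XY\mp(-1)^{|S||T|-|S\cap T|}YX .$$ *)

theory Defs
  imports "HOL-Algebra.Algebraic_Closure_Type" "HOL-Library.Poly_Mapping"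
begin

section \<open>The ground field\<close>

text \<open>The field is the real or the complex numbers, up to isomorphism of fields.\<close>

class real_or_complex = field +
  assumes real_or_complex:
    "(ring_of_type_algebra :: 'a ring) \<simeq> (ring_of_type_algebra :: real ring) \<or>
     (ring_of_type_algebra :: 'a ring) \<simeq> (ring_of_type_algebra :: complex ring)"

instance real :: real_or_complex
  by standard (use ring_iso_set_refl in \<open>auto simp: is_ring_iso_def\<close>)

instance complex :: real_or_complex
  by standard (use ring_iso_set_refl in \<open>auto simp: is_ring_iso_def\<close>)


section \<open>Associative algebras\<close>

text \<open>The library locale \<open>algebra\<close> is restricted to commutative algebras.\<close>

locale assoc_algebra = module + ring M +
  assumes smult_mult_left:
      "\<lbrakk> a \<in> carrier R; x \<in> carrier M; y \<in> carrier M \<rbrakk> \<Longrightarrow>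
      (a \<odot>\<^bsub>M\<^esub> x) \<otimes>\<^bsub>M\<^esub> y = a \<odot>\<^bsub>M\<^esub> (x \<otimes>\<^bsub>M\<^esub> y)"
    and smult_mult_right:
      "\<lbrakk> a \<in> carrier R; x \<in> carrier M; y \<in> carrier M \<rbrakk> \<Longrightarrow>
      x \<otimes>\<^bsub>M\<^esub> (a \<odot>\<^bsub>M\<^esub> y) = a \<odot>\<^bsub>M\<^esub> (x \<otimes>\<^bsub>M\<^esub> y)"

subsection \<open>Monoid algebras\<close>

definition monoid_algebra :: "('m, 'z) monoid_scheme \<Rightarrow> ('k::field, 'm \<Rightarrow>\<^sub>0 'k) module" where
  "monoid_algebra G =
    \<lparr> carrier = {f. Poly_Mapping.keys f \<subseteq> carrier G},
      monoid.mult = (\<lambda>f g. \<Sum>a\<in>Poly_Mapping.keys f. \<Sum>b\<in>Poly_Mapping.keys g.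
                Poly_Mapping.single (a \<otimes>\<^bsub>G\<^esub> b) (poly_mapping.lookup f a * poly_mapping.lookup g b)),
      one = Poly_Mapping.single \<one>\<^bsub>G\<^esub> 1,
      ring.zero = 0,
      add = (+),
      module.smult = (\<lambda>c f. Poly_Mapping.map ((*) c) f) \<rparr>"

lemma monoid_algebra_simps [simp]:
  "carrier (monoid_algebra G) = {f. Poly_Mapping.keys f \<subseteq> carrier G}"
  "\<zero>\<^bsub>monoid_algebra G\<^esub> = 0"
  "f \<oplus>\<^bsub>monoid_algebra G\<^esub> g = f + g"
  "\<one>\<^bsub>monoid_algebra G\<^esub> = Poly_Mapping.single \<one>\<^bsub>G\<^esub> 1"
  "c \<odot>\<^bsub>monoid_algebra G\<^esub> f = Poly_Mapping.map ((*) c) f"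
  by (simp_all add: monoid_algebra_def)

lemma lookup_map_scale [simp]:
  "poly_mapping.lookup (Poly_Mapping.map ((*) c) f) a = c * poly_mapping.lookup f a" for c :: "'k::field"
  by transfer (auto simp: when_def)

lemma monoid_algebra_mult_superset:
  assumes "finite S" "finite T" "Poly_Mapping.keys f \<subseteq> S" "Poly_Mapping.keys g \<subseteq> T"
  shows "f \<otimes>\<^bsub>monoid_algebra G\<^esub> g =
    (\<Sum>a\<in>S. \<Sum>b\<in>T. Poly_Mapping.single (a \<otimes>\<^bsub>G\<^esub> b) (poly_mapping.lookup f a * poly_mapping.lookup g b))"
proof -
  have "(\<Sum>b\<in>Poly_Mapping.keys g. Poly_Mapping.single (a \<otimes>\<^bsub>G\<^esub> b) (poly_mapping.lookup f a * poly_mapping.lookup g b)) =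
    (\<Sum>b\<in>T. Poly_Mapping.single (a \<otimes>\<^bsub>G\<^esub> b) (poly_mapping.lookup f a * poly_mapping.lookup g b))" for a
    by (rule sum.mono_neutral_left) (use assms in \<open>auto simp: in_keys_iff\<close>)
  moreover have "(\<Sum>a\<in>Poly_Mapping.keys f. \<Sum>b\<in>T. Poly_Mapping.single (a \<otimes>\<^bsub>G\<^esub> b) (poly_mapping.lookup f a * poly_mapping.lookup g b)) =
    (\<Sum>a\<in>S. \<Sum>b\<in>T. Poly_Mapping.single (a \<otimes>\<^bsub>G\<^esub> b) (poly_mapping.lookup f a * poly_mapping.lookup g b))"
    by (rule sum.mono_neutral_left) (use assms in \<open>auto simp: in_keys_iff\<close>)
  ultimately show ?thesis by (simp add: monoid_algebra_def)
qed

lemma monoid_algebra_mult_add_left: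
  "(f + g) \<otimes>\<^bsub>monoid_algebra G\<^esub> h = f \<otimes>\<^bsub>monoid_algebra G\<^esub> h + g \<otimes>\<^bsub>monoid_algebra G\<^esub> h"
proof -
  let ?S = "Poly_Mapping.keys f \<union> Poly_Mapping.keys g"
  note * = monoid_algebra_mult_superset[of ?S "Poly_Mapping.keys h" _ h G]
  show ?thesis
    using keys_add[of f g]
    by (simp add: * lookup_add distrib_right single_add sum.distrib)
qed

lemma monoid_algebra_mult_add_right:
  "h \<otimes>\<^bsub>monoid_algebra G\<^esub> (f + g) = h \<otimes>\<^bsub>monoid_algebra G\<^esub> f + h \<otimes>\<^bsub>monoid_algebra G\<^esub> g"
proof -
  let ?S = "Poly_Mapping.keys f \<union> Poly_Mapping.keys g"
  note * = monoid_algebra_mult_superset[of "Poly_Mapping.keys h" ?S h _ G]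
  show ?thesis
    using keys_add[of f g]
    by (simp add: * lookup_add distrib_left single_add sum.distrib)
qed

lemma monoid_algebra_mult_zero [simp]:
  "0 \<otimes>\<^bsub>monoid_algebra G\<^esub> h = 0" "h \<otimes>\<^bsub>monoid_algebra G\<^esub> 0 = 0"
  by (simp_all add: monoid_algebra_def)

lemma monoid_algebra_mult_sum_left:
  "(\<Sum>i\<in>I. f i) \<otimes>\<^bsub>monoid_algebra G\<^esub> h = (\<Sum>i\<in>I. f i \<otimes>\<^bsub>monoid_algebra G\<^esub> h)"
  by (induction I rule: infinite_finite_induct) (simp_all add: monoid_algebra_mult_add_left)

lemma monoid_algebra_mult_sum_right:
  "h \<otimes>\<^bsub>monoid_algebra G\<^esub> (\<Sum>i\<in>I. f i) = (\<Sum>i\<in>I. h \<otimes>\<^bsub>monoid_algebra G\<^esub> f i)"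
  by (induction I rule: infinite_finite_induct) (simp_all add: monoid_algebra_mult_add_right)

lemma monoid_algebra_mult_single [simp]:
  "Poly_Mapping.single a c \<otimes>\<^bsub>monoid_algebra G\<^esub> Poly_Mapping.single b d =
     Poly_Mapping.single (a \<otimes>\<^bsub>G\<^esub> b) (c * d)"
  by (simp add: monoid_algebra_mult_superset[of "{a}" "{b}"])

lemma poly_mapping_sum_single: "f = (\<Sum>a\<in>Poly_Mapping.keys f. Poly_Mapping.single a (poly_mapping.lookup f a))"
  by (rule poly_mapping_eqI) (simp add: lookup_sum lookup_single when_def in_keys_iff)

lemma monoid_algebra_mult_def':
  "f \<otimes>\<^bsub>monoid_algebra G\<^esub> g = (\<Sum>a\<in>Poly_Mapping.keys f. \<Sum>b\<in>Poly_Mapping.keys g.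
     Poly_Mapping.single (a \<otimes>\<^bsub>G\<^esub> b) (poly_mapping.lookup f a * poly_mapping.lookup g b))"
  by (simp add: monoid_algebra_def)

lemma monoid_algebra_mult_closed:
  assumes "monoid G" "Poly_Mapping.keys f \<subseteq> carrier G" "Poly_Mapping.keys g \<subseteq> carrier G"
  shows "Poly_Mapping.keys (f \<otimes>\<^bsub>monoid_algebra G\<^esub> g) \<subseteq> carrier G"
proof -
  interpret monoid G by fact
  have "(\<Sum>a\<in>Poly_Mapping.keys f. \<Sum>b\<in>Poly_Mapping.keys g. poly_mapping.lookup (Poly_Mapping.single (a \<otimes>\<^bsub>G\<^esub> b) (poly_mapping.lookup f a * poly_mapping.lookup g b)) x) = 0"
    if "x \<notin> carrier G" for x
    by (intro sum.neutral ballI) (use that assms in \<open>auto simp: lookup_single when_def\<close>)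
  then show ?thesis
    unfolding monoid_algebra_mult_def' subset_iff in_keys_iff lookup_sum by blast
qed

lemma monoid_algebra_mult_assoc:
  assumes "monoid G" "Poly_Mapping.keys f \<subseteq> carrier G" "Poly_Mapping.keys g \<subseteq> carrier G" "Poly_Mapping.keys h \<subseteq> carrier G"
  shows "(f \<otimes>\<^bsub>monoid_algebra G\<^esub> g) \<otimes>\<^bsub>monoid_algebra G\<^esub> h =
    f \<otimes>\<^bsub>monoid_algebra G\<^esub> (g \<otimes>\<^bsub>monoid_algebra G\<^esub> h)"
proof -
  interpret monoid G by fact
  let ?m = "monoid.mult (monoid_algebra G)"
  have "?m (?m f g) h = ?m (?m f g) (\<Sum>c\<in>Poly_Mapping.keys h. Poly_Mapping.single c (poly_mapping.lookup h c))"
    using poly_mapping_sum_single[of h] by simp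
  also have "\<dots> = (\<Sum>a\<in>Poly_Mapping.keys f. \<Sum>b\<in>Poly_Mapping.keys g. \<Sum>c\<in>Poly_Mapping.keys h.
      Poly_Mapping.single (a \<otimes>\<^bsub>G\<^esub> b \<otimes>\<^bsub>G\<^esub> c) (poly_mapping.lookup f a * poly_mapping.lookup g b * poly_mapping.lookup h c))"
    unfolding monoid_algebra_mult_def'[of G f g]
    by (simp only: monoid_algebra_mult_sum_left)
      (simp only: monoid_algebra_mult_sum_right monoid_algebra_mult_single)
  also have "\<dots> = (\<Sum>a\<in>Poly_Mapping.keys f. \<Sum>b\<in>Poly_Mapping.keys g. \<Sum>c\<in>Poly_Mapping.keys h.
      Poly_Mapping.single (a \<otimes>\<^bsub>G\<^esub> (b \<otimes>\<^bsub>G\<^esub> c)) (poly_mapping.lookup f a * (poly_mapping.lookup g b * poly_mapping.lookup h c)))"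
    by (intro sum.cong refl) (use assms in \<open>auto simp: m_assoc mult.assoc subset_iff\<close>)
  also have "\<dots> = ?m (\<Sum>a\<in>Poly_Mapping.keys f. Poly_Mapping.single a (poly_mapping.lookup f a)) (?m g h)"
    unfolding monoid_algebra_mult_def'[of G g h]
    by (simp only: monoid_algebra_mult_sum_left)
      (simp only: monoid_algebra_mult_sum_right monoid_algebra_mult_single)
  also have "\<dots> = ?m f (?m g h)"
    using poly_mapping_sum_single[of f] by simp
  finally show ?thesis .
qed

lemma monoid_algebra_mult_one:
  assumes "monoid G" "Poly_Mapping.keys f \<subseteq> carrier G"
  shows "Poly_Mapping.single \<one>\<^bsub>G\<^esub> 1 \<otimes>\<^bsub>monoid_algebra G\<^esub> f = f"
    and "f \<otimes>\<^bsub>monoid_algebra G\<^esub> Poly_Mapping.single \<one>\<^bsub>G\<^esub> 1 = f"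
proof -
  interpret monoid G by fact
  have "Poly_Mapping.single \<one>\<^bsub>G\<^esub> 1 \<otimes>\<^bsub>monoid_algebra G\<^esub> (\<Sum>a\<in>Poly_Mapping.keys f. Poly_Mapping.single a (poly_mapping.lookup f a))
      = (\<Sum>a\<in>Poly_Mapping.keys f. Poly_Mapping.single a (poly_mapping.lookup f a))"
    unfolding monoid_algebra_mult_sum_right
    by (intro sum.cong refl) (use assms in \<open>auto simp: subset_iff\<close>)
  then show "Poly_Mapping.single \<one>\<^bsub>G\<^esub> 1 \<otimes>\<^bsub>monoid_algebra G\<^esub> f = f"
    using poly_mapping_sum_single[of f] by simp
  have "(\<Sum>a\<in>Poly_Mapping.keys f. Poly_Mapping.single a (poly_mapping.lookup f a)) \<otimes>\<^bsub>monoid_algebra G\<^esub> Poly_Mapping.single \<one>\<^bsub>G\<^esub> 1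
      = (\<Sum>a\<in>Poly_Mapping.keys f. Poly_Mapping.single a (poly_mapping.lookup f a))"
    unfolding monoid_algebra_mult_sum_left
    by (intro sum.cong refl) (use assms in \<open>auto simp: subset_iff\<close>)
  then show "f \<otimes>\<^bsub>monoid_algebra G\<^esub> Poly_Mapping.single \<one>\<^bsub>G\<^esub> 1 = f"
    using poly_mapping_sum_single[of f] by simp
qed

lemma keys_map_scale: "Poly_Mapping.keys (Poly_Mapping.map ((*) c) f) \<subseteq> Poly_Mapping.keys f" for c :: "'k::field"
  by (auto simp: in_keys_iff)

lemma monoid_algebra_mult_scale:
  "Poly_Mapping.map ((*) c) f \<otimes>\<^bsub>monoid_algebra G\<^esub> g = Poly_Mapping.map ((*) c) (f \<otimes>\<^bsub>monoid_algebra G\<^esub> g)"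
  "f \<otimes>\<^bsub>monoid_algebra G\<^esub> Poly_Mapping.map ((*) c) g = Poly_Mapping.map ((*) c) (f \<otimes>\<^bsub>monoid_algebra G\<^esub> g)"
  for c :: "'k::field"
proof -
  show "Poly_Mapping.map ((*) c) f \<otimes>\<^bsub>monoid_algebra G\<^esub> g = Poly_Mapping.map ((*) c) (f \<otimes>\<^bsub>monoid_algebra G\<^esub> g)"
    by (rule poly_mapping_eqI)
      (simp add: monoid_algebra_mult_superset[of "Poly_Mapping.keys f" "Poly_Mapping.keys g"] keys_map_scale lookup_sum
        lookup_single sum_distrib_left when_def mult_ac if_distrib cong: if_cong)
  show "f \<otimes>\<^bsub>monoid_algebra G\<^esub> Poly_Mapping.map ((*) c) g = Poly_Mapping.map ((*) c) (f \<otimes>\<^bsub>monoid_algebra G\<^esub> g)"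
    by (rule poly_mapping_eqI)
      (simp add: monoid_algebra_mult_superset[of "Poly_Mapping.keys f" "Poly_Mapping.keys g"] keys_map_scale lookup_sum
        lookup_single sum_distrib_left when_def mult_ac if_distrib cong: if_cong)
qed

lemma ring_monoid_algebra:
  assumes "monoid G"
  shows "ring (monoid_algebra G :: ('k::field, 'm \<Rightarrow>\<^sub>0 'k) module)"
proof (rule ringI)
  interpret monoid G by fact
  let ?A = "monoid_algebra G :: ('k, 'm \<Rightarrow>\<^sub>0 'k) module"
  show "abelian_group ?A"
  proof (rule abelian_groupI)
    show "x \<oplus>\<^bsub>?A\<^esub> y \<in> carrier ?A" if "x \<in> carrier ?A" "y \<in> carrier ?A" for x y
      using that keys_add[of x y] by auto
    show "\<exists>y\<in>carrier ?A. y \<oplus>\<^bsub>?A\<^esub> x = \<zero>\<^bsub>?A\<^esub>" if "x \<in> carrier ?A" for x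
      by (rule bexI[of _ "- x"]) (use that in \<open>auto simp: in_keys_iff subset_iff\<close>)
  qed (simp_all add: add_ac)
  show "monoid ?A"
    by (rule monoidI)
      (simp_all add: monoid_algebra_mult_closed[OF assms] monoid_algebra_mult_assoc[OF assms]
        monoid_algebra_mult_one[OF assms])
qed (simp_all add: monoid_algebra_mult_add_left monoid_algebra_mult_add_right)

lemma assoc_algebra_monoid_algebra:
  assumes "monoid G"
  shows "assoc_algebra ring_of_type_algebra (monoid_algebra G :: ('k::field, 'm \<Rightarrow>\<^sub>0 'k) module)"
proof -
  let ?A = "monoid_algebra G :: ('k, 'm \<Rightarrow>\<^sub>0 'k) module"
  have "module ring_of_type_algebra ?A"
  proof (rule moduleI)
    show "cring (ring_of_type_algebra :: 'k ring)" by (rule cring_from_type_algebra)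
    show "abelian_group ?A" by (rule ring.is_abelian_group[OF ring_monoid_algebra[OF assms]])
  qed (use keys_map_scale in \<open>fastforce intro: poly_mapping_eqI
        simp: ring_of_type_algebra_def lookup_add algebra_simps\<close>)+
  then show ?thesis
    by (intro assoc_algebra.intro assoc_algebra_axioms.intro ring_monoid_algebra[OF assms])
      (simp_all add: monoid_algebra_mult_scale)
qed

subsection \<open>Quotients, presentations and tensor products\<close>

definition quotient_algebra :: "('k, 'a) module \<Rightarrow> 'a set \<Rightarrow> ('k, 'a set) module" where
  "quotient_algebra A I =
    \<lparr> carrier = carrier (A Quot I), monoid.mult = monoid.mult (A Quot I), one = one (A Quot I),
      ring.zero = ring.zero (A Quot I), add = add (A Quot I),
      module.smult = (\<lambda>c Z. \<Union>x\<in>Z. I +>\<^bsub>A\<^esub> (c \<odot>\<^bsub>A\<^esub> x)) \<rparr>"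

lemma quotient_algebra_simps [simp]:
  "carrier (quotient_algebra A I) = carrier (A Quot I)"
  "monoid.mult (quotient_algebra A I) = monoid.mult (A Quot I)"
  "one (quotient_algebra A I) = one (A Quot I)"
  "ring.zero (quotient_algebra A I) = ring.zero (A Quot I)"
  "add (quotient_algebra A I) = add (A Quot I)"
  by (simp_all add: quotient_algebra_def)

definition free_monoid :: "'g set \<Rightarrow> 'g list monoid" where
  "free_monoid Z = \<lparr> carrier = lists Z, monoid.mult = (@), one = [] \<rparr>"

definition free_algebra :: "'g set \<Rightarrow> ('k::field, 'g list \<Rightarrow>\<^sub>0 'k) module" where
  "free_algebra Z = monoid_algebra (free_monoid Z)"

definition free_gen :: "'g \<Rightarrow> ('g list \<Rightarrow>\<^sub>0 'k::field)" where
  "free_gen g = Poly_Mapping.single [g] 1"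

text \<open>The ideals of \<^theory>\<open>HOL-Algebra.Ideal\<close> are two-sided.\<close>

definition presented_algebra ::
    "'g set \<Rightarrow> ('g list \<Rightarrow>\<^sub>0 'k::field) set \<Rightarrow> ('k, ('g list \<Rightarrow>\<^sub>0 'k) set) module" where
  "presented_algebra Z rels = quotient_algebra (free_algebra Z) (Idl\<^bsub>free_algebra Z\<^esub> rels)"

definition presented_gen ::
    "'g set \<Rightarrow> ('g list \<Rightarrow>\<^sub>0 'k::field) set \<Rightarrow> 'g \<Rightarrow> ('g list \<Rightarrow>\<^sub>0 'k) set" where
  "presented_gen Z rels g = (Idl\<^bsub>free_algebra Z\<^esub> rels) +>\<^bsub>free_algebra Z\<^esub> free_gen g"

text \<open>
  The tensor product of two algebras over the field, as the vector space with basis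
  \<open>carrier A \<times> carrier B\<close> modulo the bilinearity relations. That vector space carries the
  product of the monoid algebra of the multiplicative monoid of \<open>A \<times> B\<close>; the span of the
  bilinearity relations is a two-sided ideal for it, so it is the ideal they generate.
\<close>

definition bilinearity_relations ::
    "('k::field, 'a) module \<Rightarrow> ('k, 'b) module \<Rightarrow> ('a \<times> 'b \<Rightarrow>\<^sub>0 'k) set" where
  "bilinearity_relations A B =
     {Poly_Mapping.single (a \<oplus>\<^bsub>A\<^esub> a', b) 1 - Poly_Mapping.single (a, b) 1 - Poly_Mapping.single (a', b) 1
        | a a' b. a \<in> carrier A \<and> a' \<in> carrier A \<and> b \<in> carrier B} \<union>
     {Poly_Mapping.single (a, b \<oplus>\<^bsub>B\<^esub> b') 1 - Poly_Mapping.single (a, b) 1 - Poly_Mapping.single (a, b') 1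
        | a b b'. a \<in> carrier A \<and> b \<in> carrier B \<and> b' \<in> carrier B} \<union>
     {Poly_Mapping.single (c \<odot>\<^bsub>A\<^esub> a, b) 1 - Poly_Mapping.single (a, b) c
        | a b c. a \<in> carrier A \<and> b \<in> carrier B} \<union>
     {Poly_Mapping.single (a, c \<odot>\<^bsub>B\<^esub> b) 1 - Poly_Mapping.single (a, b) c
        | a b c. a \<in> carrier A \<and> b \<in> carrier B}"

definition tensor_ideal ::
    "('k::field, 'a) module \<Rightarrow> ('k, 'b) module \<Rightarrow> ('a \<times> 'b \<Rightarrow>\<^sub>0 'k) set" where
  "tensor_ideal A B = Idl\<^bsub>monoid_algebra (A \<times>\<times> B)\<^esub> (bilinearity_relations A B)"

definition tensor_algebra_product ::
    "('k::field, 'a) module \<Rightarrow> ('k, 'b) module \<Rightarrow> ('k, ('a \<times> 'b \<Rightarrow>\<^sub>0 'k) set) module" where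
  "tensor_algebra_product A B = quotient_algebra (monoid_algebra (A \<times>\<times> B)) (tensor_ideal A B)"

definition pure_tensor ::
    "('k::field, 'a) module \<Rightarrow> ('k, 'b) module \<Rightarrow> 'a \<Rightarrow> 'b \<Rightarrow> ('a \<times> 'b \<Rightarrow>\<^sub>0 'k) set" where
  "pure_tensor A B a b =
     tensor_ideal A B +>\<^bsub>monoid_algebra (A \<times>\<times> B)\<^esub> Poly_Mapping.single (a, b) 1"

lemma quotient_coset_smult:
  fixes R :: "('k, 'a) module" (structure)
  assumes "ideal I R" "assoc_algebra K R" "c \<in> carrier K" "x \<in> carrier R"
  shows "c \<odot>\<^bsub>quotient_algebra R I\<^esub> (I +> x) = I +> (c \<odot>\<^bsub>R\<^esub> x)"
proof -
  interpret ideal I R by fact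
  interpret A: assoc_algebra K R by fact
  have closed: "c \<odot>\<^bsub>R\<^esub> i \<in> I" if "i \<in> I" for i
  proof -
    have "c \<odot>\<^bsub>R\<^esub> i = (c \<odot>\<^bsub>R\<^esub> \<one>) \<otimes> i"
      using that assms Icarr by (simp add: A.smult_mult_left)
    then show ?thesis using that assms I_l_closed by simp
  qed
  then have *: "I +> (c \<odot>\<^bsub>R\<^esub> y) = I +> (c \<odot>\<^bsub>R\<^esub> x)" if "y \<in> I +> x" for y
  proof -
    obtain i where i: "i \<in> I" "y = i \<oplus> x" using \<open>y \<in> I +> x\<close> by (auto simp: a_r_coset_def')
    then have "c \<odot>\<^bsub>R\<^esub> y = (c \<odot>\<^bsub>R\<^esub> i) \<oplus> (c \<odot>\<^bsub>R\<^esub> x)"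
      using assms Icarr by (simp add: A.smult_r_distr)
    moreover have "c \<odot>\<^bsub>R\<^esub> i \<in> I" using i closed by blast
    ultimately have "c \<odot>\<^bsub>R\<^esub> y \<in> I +> (c \<odot>\<^bsub>R\<^esub> x)"
      unfolding a_r_coset_def' by blast
    then show ?thesis
      using a_repr_independence'[of "c \<odot>\<^bsub>R\<^esub> y" "c \<odot>\<^bsub>R\<^esub> x"] assms
      by (simp only: A.smult_closed)
  qed
  have "x \<in> I +> x" using assms a_rcos_self by blast
  then have "(\<Union>y\<in>I +> x. I +> (c \<odot>\<^bsub>R\<^esub> y)) = I +> (c \<odot>\<^bsub>R\<^esub> x)"
    using * by blast
  then show ?thesis by (simp only: quotient_algebra_def module.simps)
qed

lemma assoc_algebra_quotient:
  fixes R :: "('k, 'a) module" (structure)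
  assumes "ideal I R" "assoc_algebra K R"
  shows "assoc_algebra K (quotient_algebra R I)"
proof -
  interpret ideal I R by fact
  interpret A: assoc_algebra K R by fact
  interpret Q: ring "R Quot I" by (rule quotient_is_ring)
  let ?Q = "quotient_algebra R I"
  have Q: "ring ?Q"
  proof (rule ringI)
    show "abelian_group ?Q"
      by (rule abelian_groupI) (simp_all add: Q.a_ac Q.add.l_inv_ex)
    show "Group.monoid ?Q"
      by (rule monoidI) (simp_all add: Q.m_assoc)
  qed (simp_all add: Q.l_distr Q.r_distr)
  have ex: "\<exists>x\<in>carrier R. Z = I +> x" if "Z \<in> carrier (R Quot I)" for Z
    using that by (auto simp: FactRing_def A_RCOSETS_def')
  have cl: "I +> x \<in> carrier (R Quot I)" if "x \<in> carrier R" for x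
    using that by (auto simp: FactRing_def A_RCOSETS_def')
  have ad: "(I +> x) \<oplus>\<^bsub>R Quot I\<^esub> (I +> y) = I +> (x \<oplus> y)" if "x \<in> carrier R" "y \<in> carrier R" for x y
    using that by (simp add: FactRing_def a_rcos_sum)
  have mu: "(I +> x) \<otimes>\<^bsub>R Quot I\<^esub> (I +> y) = I +> (x \<otimes> y)" if "x \<in> carrier R" "y \<in> carrier R" for x y
    using that by (simp add: FactRing_def rcoset_mult_add)
  note sm = quotient_coset_smult[OF assms]
  have "module K ?Q"
    apply (rule moduleI)
    apply (rule A.R.is_cring)
    apply (rule ring.is_abelian_group[OF Q])
    apply (auto dest!: ex simp: ad sm cl A.smult_l_distr A.smult_r_distr A.smult_assoc1)
    done
  then show ?thesis
    apply (intro assoc_algebra.intro assoc_algebra_axioms.intro Q)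
    apply (auto dest!: ex simp: mu sm A.smult_mult_left A.smult_mult_right)
    done
qed

lemma monoid_free_monoid: "monoid (free_monoid Z)"
  by (rule monoidI) (auto simp: free_monoid_def)

lemma assoc_algebra_free_algebra:
  "assoc_algebra ring_of_type_algebra (free_algebra Z :: ('k::field, 'g list \<Rightarrow>\<^sub>0 'k) module)"
  unfolding free_algebra_def by (rule assoc_algebra_monoid_algebra[OF monoid_free_monoid])

lemma free_gen_closed: "g \<in> Z \<Longrightarrow> free_gen g \<in> carrier (free_algebra Z)"
  by (simp add: free_gen_def free_algebra_def free_monoid_def)

lemma ideal_presented:
  assumes "rels \<subseteq> carrier (free_algebra Z)"
  shows "ideal (Idl\<^bsub>free_algebra Z\<^esub> rels) (free_algebra Z)"
proof -
  interpret assoc_algebra ring_of_type_algebra "free_algebra Z" by (rule assoc_algebra_free_algebra)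
  show ?thesis by (rule genideal_ideal[OF assms])
qed

lemma assoc_algebra_presented:
  assumes "rels \<subseteq> carrier (free_algebra Z)"
  shows "assoc_algebra ring_of_type_algebra (presented_algebra Z rels)"
  unfolding presented_algebra_def
  by (rule assoc_algebra_quotient[OF ideal_presented[OF assms] assoc_algebra_free_algebra])

lemma bilinearity_relations_closed:
  assumes "assoc_algebra ring_of_type_algebra A" "assoc_algebra ring_of_type_algebra B"
  shows "bilinearity_relations A B \<subseteq> carrier (monoid_algebra (A \<times>\<times> B))"
proof -
  interpret A: assoc_algebra ring_of_type_algebra A by fact
  interpret B: assoc_algebra ring_of_type_algebra B by fact
  have c: "c \<in> carrier ring_of_type_algebra" for c :: 'a by (simp add: ring_of_type_algebra_def)
  have s: "Poly_Mapping.keys (Poly_Mapping.single p d) \<subseteq> carrier A \<times> carrier B"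
    if "p \<in> carrier A \<times> carrier B" for p :: "'b \<times> 'c" and d :: 'a
    using that by auto
  have d: "Poly_Mapping.keys (f - g) \<subseteq> carrier A \<times> carrier B"
    if "Poly_Mapping.keys f \<subseteq> carrier A \<times> carrier B" "Poly_Mapping.keys g \<subseteq> carrier A \<times> carrier B"
    for f g :: "'b \<times> 'c \<Rightarrow>\<^sub>0 'a"
    using that keys_diff[of f g] by blast
  show ?thesis
    unfolding bilinearity_relations_def monoid_algebra_simps carrier_DirProd
    apply (intro Un_least; rule subsetI; elim CollectE exE conjE; hypsubst; rule CollectI)
       apply (intro d s SigmaI A.M.a_closed B.M.a_closed A.smult_closed B.smult_closed c, assumption+)+
    done
qed

lemma ideal_tensor_ideal:
  assumes "assoc_algebra ring_of_type_algebra A" "assoc_algebra ring_of_type_algebra B"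
  shows "ideal (tensor_ideal A B) (monoid_algebra (A \<times>\<times> B))"
    and "assoc_algebra ring_of_type_algebra (tensor_algebra_product A B)"
proof -
  interpret A: assoc_algebra ring_of_type_algebra A by fact
  interpret B: assoc_algebra ring_of_type_algebra B by fact
  have m: "monoid (A \<times>\<times> B)" by (intro DirProd_monoid) unfold_locales
  interpret M: ring "monoid_algebra (A \<times>\<times> B) :: ('a, 'b \<times> 'c \<Rightarrow>\<^sub>0 'a) module"
    by (rule ring_monoid_algebra[OF m])
  show I: "ideal (tensor_ideal A B) (monoid_algebra (A \<times>\<times> B))"
    unfolding tensor_ideal_def by (rule M.genideal_ideal[OF bilinearity_relations_closed[OF assms]])
  show "assoc_algebra ring_of_type_algebra (tensor_algebra_product A B)"
    unfolding tensor_algebra_product_def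
    by (rule assoc_algebra_quotient[OF I assoc_algebra_monoid_algebra[OF m]])
qed


section \<open>The algebras of the statement\<close>

definition commutator :: "('a, 'z) ring_scheme \<Rightarrow> 'a \<Rightarrow> 'a \<Rightarrow> 'a" where
  "commutator R a b = a \<otimes>\<^bsub>R\<^esub> b \<ominus>\<^bsub>R\<^esub> b \<otimes>\<^bsub>R\<^esub> a"

datatype xp_gen = Gen_x nat | Gen_p nat

definition xp_gens :: "nat \<Rightarrow> xp_gen set" where
  "xp_gens N = Gen_x ` {1..N} \<union> Gen_p ` {1..N}"

definition xp_relations :: "nat \<Rightarrow> (xp_gen list \<Rightarrow>\<^sub>0 'k::field) set" where
  "xp_relations N =
    (let F = free_algebra (xp_gens N);
         x = (\<lambda>i. free_gen (Gen_x i));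
         p = (\<lambda>i. free_gen (Gen_p i))
     in \<Union>i\<in>{1..N}. \<Union>j\<in>{1..N}.
       {commutator F (x i) (x j),
        commutator F (p i) (p j),
        commutator F ((1/2) \<odot>\<^bsub>F\<^esub> (\<Oplus>\<^bsub>F\<^esub>k\<in>{1..N}. p k \<otimes>\<^bsub>F\<^esub> p k)) (x j) \<ominus>\<^bsub>F\<^esub> p j,
        commutator F ((1/2) \<odot>\<^bsub>F\<^esub> (\<Oplus>\<^bsub>F\<^esub>k\<in>{1..N}. x k \<otimes>\<^bsub>F\<^esub> x k)) (p j) \<oplus>\<^bsub>F\<^esub> x j})"

definition xp_algebra :: "nat \<Rightarrow> ('k::field, (xp_gen list \<Rightarrow>\<^sub>0 'k) set) module" where
  "xp_algebra N = presented_algebra (xp_gens N) (xp_relations N)"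

definition clifford_relations :: "nat \<Rightarrow> 'k::field \<Rightarrow> (nat list \<Rightarrow>\<^sub>0 'k) set" where
  "clifford_relations N \<epsilon> =
    (let F = free_algebra {1..N}; e = free_gen
     in \<Union>i\<in>{1..N}. \<Union>j\<in>{1..N}.
       {(e i \<otimes>\<^bsub>F\<^esub> e j \<oplus>\<^bsub>F\<^esub> e j \<otimes>\<^bsub>F\<^esub> e i) \<ominus>\<^bsub>F\<^esub> (2 * \<epsilon> * (if i = j then 1 else 0)) \<odot>\<^bsub>F\<^esub> \<one>\<^bsub>F\<^esub>})"

definition clifford_algebra :: "nat \<Rightarrow> 'k::field \<Rightarrow> ('k, (nat list \<Rightarrow>\<^sub>0 'k) set) module" where
  "clifford_algebra N \<epsilon> = presented_algebra {1..N} (clifford_relations N \<epsilon>)"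

type_synonym 'k xpc = "((xp_gen list \<Rightarrow>\<^sub>0 'k) set \<times> (nat list \<Rightarrow>\<^sub>0 'k) set \<Rightarrow>\<^sub>0 'k) set"

definition xpc_algebra :: "nat \<Rightarrow> 'k::field \<Rightarrow> ('k, 'k xpc) module" where
  "xpc_algebra N \<epsilon> = tensor_algebra_product (xp_algebra N) (clifford_algebra N \<epsilon>)"

lemma xp_relations_closed:
  "(xp_relations N :: (xp_gen list \<Rightarrow>\<^sub>0 'k::field) set) \<subseteq> carrier (free_algebra (xp_gens N))"
proof -
  interpret F: assoc_algebra "ring_of_type_algebra :: 'k ring" "free_algebra (xp_gens N)"
    by (rule assoc_algebra_free_algebra)
  have c: "c \<in> carrier ring_of_type_algebra" for c :: 'k by (simp add: ring_of_type_algebra_def)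
  have g: "free_gen (Gen_x i) \<in> carrier (free_algebra (xp_gens N))"
    "free_gen (Gen_p i) \<in> carrier (free_algebra (xp_gens N))" if "i \<in> {1..N}" for i
    using that by (auto intro!: free_gen_closed simp: xp_gens_def)
  show ?thesis
    unfolding xp_relations_def Let_def commutator_def
    by (intro UN_least insert_subsetI empty_subsetI F.minus_closed F.m_closed F.a_closed
        F.smult_closed F.M.finsum_closed c g Pi_I)
qed

lemma clifford_relations_closed:
  "clifford_relations N \<epsilon> \<subseteq> carrier (free_algebra {1..N})"
proof -
  interpret F: assoc_algebra "ring_of_type_algebra :: 'a ring" "free_algebra {1..N}"
    by (rule assoc_algebra_free_algebra)
  have c: "c \<in> carrier ring_of_type_algebra" for c :: 'a by (simp add: ring_of_type_algebra_def)
  show ?thesis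
    unfolding clifford_relations_def Let_def
    by (intro UN_least insert_subsetI empty_subsetI F.minus_closed F.m_closed F.a_closed
        F.smult_closed c F.one_closed free_gen_closed)
qed

lemma assoc_algebra_xpc: "assoc_algebra ring_of_type_algebra (xpc_algebra N \<epsilon>)"
  unfolding xpc_algebra_def xp_algebra_def clifford_algebra_def
  by (rule ideal_tensor_ideal(2)[OF assoc_algebra_presented[OF xp_relations_closed]
        assoc_algebra_presented[OF clifford_relations_closed]])


section \<open>Operators\<close>

definition op_x :: "nat \<Rightarrow> 'k::field \<Rightarrow> nat \<Rightarrow> 'k xpc" where
  "op_x N \<epsilon> i = pure_tensor (xp_algebra N) (clifford_algebra N \<epsilon>)
     (presented_gen (xp_gens N) (xp_relations N) (Gen_x i)) \<one>\<^bsub>clifford_algebra N \<epsilon>\<^esub>"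

definition op_p :: "nat \<Rightarrow> 'k::field \<Rightarrow> nat \<Rightarrow> 'k xpc" where
  "op_p N \<epsilon> i = pure_tensor (xp_algebra N) (clifford_algebra N \<epsilon>)
     (presented_gen (xp_gens N) (xp_relations N) (Gen_p i)) \<one>\<^bsub>clifford_algebra N \<epsilon>\<^esub>"

definition op_e :: "nat \<Rightarrow> 'k::field \<Rightarrow> nat \<Rightarrow> 'k xpc" where
  "op_e N \<epsilon> i = pure_tensor (xp_algebra N) (clifford_algebra N \<epsilon>)
     \<one>\<^bsub>xp_algebra N\<^esub> (presented_gen {1..N} (clifford_relations N \<epsilon>) i)"

definition op_D :: "nat \<Rightarrow> 'k::field \<Rightarrow> 'k xpc" where
  "op_D N \<epsilon> = (\<Oplus>\<^bsub>xpc_algebra N \<epsilon>\<^esub>i\<in>{1..N}. op_e N \<epsilon> i \<otimes>\<^bsub>xpc_algebra N \<epsilon>\<^esub> op_p N \<epsilon> i)"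

definition op_x_set :: "nat \<Rightarrow> 'k::field \<Rightarrow> nat set \<Rightarrow> 'k xpc" where
  "op_x_set N \<epsilon> S = (\<Oplus>\<^bsub>xpc_algebra N \<epsilon>\<^esub>s\<in>S. op_x N \<epsilon> s \<otimes>\<^bsub>xpc_algebra N \<epsilon>\<^esub> op_e N \<epsilon> s)"

definition op_e_list :: "nat \<Rightarrow> 'k::field \<Rightarrow> nat list \<Rightarrow> 'k xpc" where
  "op_e_list N \<epsilon> A =
     foldr (\<lambda>a u. op_e N \<epsilon> a \<otimes>\<^bsub>xpc_algebra N \<epsilon>\<^esub> u) A \<one>\<^bsub>xpc_algebra N \<epsilon>\<^esub>"

text \<open>Below, \<open>As\<close> is the sequence of lists \<open>A\<^sub>1, \<dots>, A\<^sub>r\<close> indexing an operator.\<close>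

definition index_set :: "nat list list \<Rightarrow> nat set" where
  "index_set As = foldr (\<lambda>A T. (set A \<union> T) - (set A \<inter> T)) As {}"

definition op_E :: "nat \<Rightarrow> 'k::field \<Rightarrow> nat list list \<Rightarrow> 'k xpc" where
  "op_E N \<epsilon> As =
     foldr (\<lambda>A u. op_e_list N \<epsilon> A \<otimes>\<^bsub>xpc_algebra N \<epsilon>\<^esub> u) As \<one>\<^bsub>xpc_algebra N \<epsilon>\<^esub>"

definition op_O :: "nat \<Rightarrow> 'k::field \<Rightarrow> nat list list \<Rightarrow> 'k xpc" where
  "op_O N \<epsilon> As =
    (let T = xpc_algebra N \<epsilon>; D = op_D N \<epsilon>; xS = op_x_set N \<epsilon> (index_set As); E = op_E N \<epsilon> As
     in (1/2) \<odot>\<^bsub>T\<^esub> (D \<otimes>\<^bsub>T\<^esub> xS \<otimes>\<^bsub>T\<^esub> E \<ominus>\<^bsub>T\<^esub> E \<otimes>\<^bsub>T\<^esub> xS \<otimes>\<^bsub>T\<^esub> D \<ominus>\<^bsub>T\<^esub> \<epsilon> \<odot>\<^bsub>T\<^esub> E))"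

text \<open>
  The supercommutator (with the lower sign index minus) of the operators indexed by \<open>As\<close> and
  \<open>Bs\<close>. It takes the indexing lists rather than the operators because the index sets are not
  determined by the elements of the algebra. The subtraction in the exponent never truncates.
\<close>

definition supercommutator :: "nat \<Rightarrow> 'k::field \<Rightarrow> nat list list \<Rightarrow> nat list list \<Rightarrow> 'k xpc" where
  "supercommutator N \<epsilon> As Bs =
    (let U = xpc_algebra N \<epsilon>; S = index_set As; T = index_set Bs;
         P = op_O N \<epsilon> As; Q = op_O N \<epsilon> Bs
     in P \<otimes>\<^bsub>U\<^esub> Q \<ominus>\<^bsub>U\<^esub>
          ((-1) ^ (card S * card T - card (S \<inter> T))) \<odot>\<^bsub>U\<^esub> (Q \<otimes>\<^bsub>U\<^esub> P))"

end

(*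
  Up to the term in eps, 2 O_A is the supercommutator of D with x_A e_A, and D supercommutes with every
  O_A. By the super Jacobi identity the supercommutator of O_A and O_B is therefore determined by those
  of O_A with x_B e_B and with e_B. For disjoint A and B these are explicit sums over a in A and b in B
  of Clifford monomials times e_A e_B. Writing out the same sums for the pairs ({a}, A u B - {a}) and
  adding over a in A, every summand that does not occur for (A, B) involves two indices i, j in A through
  a coefficient symmetric in i, j (such as [p_i, x_j] = [p_j, x_i]) times e_i e_j, so these cancel.
*)
theory Submission
  imports Defs
begin

text \<open>Different pairs can be compared because the bracket of O_A and O_B depends on the pair
  only through |A| + |B|, the product e_A e_B and two coefficients. Passing to ({a}, A u B - {a})
  keeps |A| + |B|, and e_a (e_a e_A e_B) = eps e_A e_B returns the same product; this square is the
  origin of the factor eps in the statement. The set A u B - {a} is the index set of O_{a,A,B}. What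
  remains are two additive identities for the coefficients. The symmetry of [p_i, x_j] is not itself
  a defining relation: it comes from commuting half the sum of the p_i^2 with x_i x_j = x_j x_i.
  Once the halves in the operators are cleared, eps and the signs are the only scalars, so the
  computation can run in a ring of class type with a sign operation in place of scalar
  multiplication. The signs depend on index sets, which an element does not determine, so they are
  carried as explicit exponents of which only the parity matters.\<close>

section \<open>Embedding rings with carriers into a type of class ring\<close>

text \<open>
  A point of this type is a choice of an element in every ring over \<open>'a\<close> at once. The product over all
  rings makes the type independent of any parameter, so a ring with a carrier that depends on local
  parameters can be mapped into it (as one factor, without preserving the unit) and computations can
  be carried out with the type-class simplifier.
\<close>

typedef ('a, 'b) ring_family =
  "\<Pi>\<^sub>E R\<in>{R :: ('a, 'b) ring_scheme. ring R}. carrier R"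
  morphisms component Abs_ring_family
proof -
  have "(\<lambda>R\<in>{R :: ('a, 'b) ring_scheme. ring R}. \<zero>\<^bsub>R\<^esub>)
      \<in> (\<Pi>\<^sub>E R\<in>{R :: ('a, 'b) ring_scheme. ring R}. carrier R)"
    by (auto intro!: abelian_monoid.zero_closed abelian_group.axioms(1) ring.is_abelian_group)
  then show ?thesis by blast
qed

setup_lifting type_definition_ring_family

instantiation ring_family :: (type, type) ring
begin

lift_definition zero_ring_family :: "('a, 'b) ring_family"
  is "\<lambda>R\<in>{R. ring R}. \<zero>\<^bsub>R\<^esub>"
  by (auto intro: ring.ring_simprules)

lift_definition plus_ring_family :: "('a, 'b) ring_family \<Rightarrow> ('a, 'b) ring_family \<Rightarrow> ('a, 'b) ring_family"
  is "\<lambda>f g. \<lambda>R\<in>{R. ring R}. f R \<oplus>\<^bsub>R\<^esub> g R"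
  by (auto intro!: ring.ring_simprules dest: PiE_mem)

lift_definition uminus_ring_family :: "('a, 'b) ring_family \<Rightarrow> ('a, 'b) ring_family"
  is "\<lambda>f. \<lambda>R\<in>{R. ring R}. \<ominus>\<^bsub>R\<^esub> f R"
  by (auto intro!: ring.ring_simprules dest: PiE_mem)

lift_definition minus_ring_family :: "('a, 'b) ring_family \<Rightarrow> ('a, 'b) ring_family \<Rightarrow> ('a, 'b) ring_family"
  is "\<lambda>f g. \<lambda>R\<in>{R. ring R}. f R \<ominus>\<^bsub>R\<^esub> g R"
  by (auto intro!: ring.ring_simprules dest: PiE_mem)

lift_definition times_ring_family :: "('a, 'b) ring_family \<Rightarrow> ('a, 'b) ring_family \<Rightarrow> ('a, 'b) ring_family"
  is "\<lambda>f g. \<lambda>R\<in>{R. ring R}. f R \<otimes>\<^bsub>R\<^esub> g R"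
  by (auto intro!: ring.ring_simprules dest: PiE_mem)

instance
proof
  fix a b c :: "('a, 'b) ring_family"
  show "a + b + c = a + (b + c)"
    by transfer (auto simp: fun_eq_iff PiE_iff intro!: ring.ring_simprules)
  show "a + b = b + a"
    by transfer (auto simp: fun_eq_iff PiE_iff intro!: ring.ring_simprules)
  show "0 + a = a"
    by transfer (auto simp: fun_eq_iff PiE_iff extensional_def ring.ring_simprules)
  show "- a + a = 0"
    by transfer (auto simp: fun_eq_iff PiE_iff intro!: ring.ring_simprules)
  show "a - b = a + - b"
    by transfer (auto simp: fun_eq_iff PiE_iff a_minus_def)
  show "a * b * c = a * (b * c)"
    by transfer (auto simp: fun_eq_iff PiE_iff intro!: ring.ring_simprules)
  show "(a + b) * c = a * c + b * c"
    by transfer (auto simp: fun_eq_iff PiE_iff intro!: ring.ring_simprules)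
  show "a * (b + c) = a * b + a * c"
    by transfer (auto simp: fun_eq_iff PiE_iff intro!: ring.ring_simprules)
qed

end

context ring
begin

definition embed :: "'a \<Rightarrow> ('a, 'b) ring_family" where
  "embed r = Abs_ring_family (\<lambda>S\<in>{S. ring S}. if S = R then r else \<zero>\<^bsub>S\<^esub>)"

lemma component_embed:
  assumes "r \<in> carrier R"
  shows "component (embed r) = (\<lambda>S\<in>{S. ring S}. if S = R then r else \<zero>\<^bsub>S\<^esub>)"
  unfolding embed_def
  by (rule Abs_ring_family_inverse) (use assms in \<open>auto intro: ring.ring_simprules\<close>)

lemma embed_inject:
  assumes "r \<in> carrier R" "s \<in> carrier R" "embed r = embed s"
  shows "r = s"
proof -
  have "component (embed r) R = component (embed s) R" by (simp add: assms(3))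
  then show ?thesis by (simp add: component_embed assms(1,2) ring_axioms)
qed

lemma embed_zero: "embed \<zero> = 0"
  by (simp add: component_inject[symmetric] component_embed zero_ring_family.rep_eq fun_eq_iff restrict_def)

lemma embed_add: "\<lbrakk>r \<in> carrier R; s \<in> carrier R\<rbrakk> \<Longrightarrow> embed (r \<oplus> s) = embed r + embed s"
  by (auto simp: component_inject[symmetric] component_embed plus_ring_family.rep_eq fun_eq_iff
      restrict_def ring.ring_simprules)

lemma embed_minus: "\<lbrakk>r \<in> carrier R; s \<in> carrier R\<rbrakk> \<Longrightarrow> embed (r \<ominus> s) = embed r - embed s"
  by (auto simp: component_inject[symmetric] component_embed minus_ring_family.rep_eq fun_eq_iff
      restrict_def ring.ring_simprules)

lemma embed_uminus: "r \<in> carrier R \<Longrightarrow> embed (\<ominus> r) = - embed r"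
  using embed_minus[of \<zero> r] by (simp add: embed_zero a_minus_def)

lemma embed_mult: "\<lbrakk>r \<in> carrier R; s \<in> carrier R\<rbrakk> \<Longrightarrow> embed (r \<otimes> s) = embed r * embed s"
  by (auto simp: component_inject[symmetric] component_embed times_ring_family.rep_eq fun_eq_iff
      restrict_def ring.ring_simprules)

lemma embed_finsum:
  assumes "finite I" "\<And>i. i \<in> I \<Longrightarrow> f i \<in> carrier R"
  shows "embed (finsum R f I) = (\<Sum>i\<in>I. embed (f i))"
  using assms by (induction I) (simp_all add: embed_zero embed_add finsum_closed Pi_iff)

end

section \<open>Signs and supercommutators\<close>

text \<open>The class \<open>ring\<close> has no unit, so the sign \<open>(-1)^n\<close> is an operation and not an element.\<close>

definition signed :: "nat \<Rightarrow> 'a::ring \<Rightarrow> 'a" where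
  "signed n y = (if even n then y else - y)"

lemma signed_signed [simp]: "signed m (signed n y) = signed (m + n) y"
  by (simp add: signed_def)

lemma signed_mult [simp]: "signed n y * z = signed n (y * z)" "y * signed n z = signed n (y * z)"
  by (simp_all add: signed_def)

lemma signed_add: "signed n (y + z) = signed n y + signed n z"
  by (simp add: signed_def)

lemma signed_diff: "signed n (y - z) = signed n y - signed n z"
  by (simp add: signed_def)

lemma signed_zero [simp]: "signed n 0 = 0"
  by (simp add: signed_def)

lemma signed_minus [simp]: "signed n (- y) = signed (Suc n) y"
  by (simp add: signed_def)

lemma signed_sum: "signed n (\<Sum>i\<in>I. f i) = (\<Sum>i\<in>I. signed n (f i))"
  by (simp add: signed_def sum_negf)

lemma signed_cong: "even m = even n \<Longrightarrow> signed m y = signed n y"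
  by (simp add: signed_def)

text \<open>The exponent \<open>n\<close>, the product of the two parities, is an argument because
  an element of the ring carries no degree.\<close>

definition superbr :: "nat \<Rightarrow> 'a \<Rightarrow> 'a \<Rightarrow> 'a::ring" where
  "superbr n y z = y * z - signed n (z * y)"

lemma superbr_sum_left: "superbr n (\<Sum>i\<in>I. f i) z = (\<Sum>i\<in>I. superbr n (f i) z)"
  by (simp add: superbr_def sum_distrib_left sum_distrib_right signed_sum sum_subtractf)

lemma superbr_sum_right: "superbr n y (\<Sum>i\<in>I. f i) = (\<Sum>i\<in>I. superbr n y (f i))"
  by (simp add: superbr_def sum_distrib_left sum_distrib_right signed_sum sum_subtractf)

lemma superbr_add_left: "superbr n (y + y') z = superbr n y z + superbr n y' z"
  by (simp add: superbr_def signed_add algebra_simps)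

lemma superbr_diff_left: "superbr n (y - y') z = superbr n y z - superbr n y' z"
  by (simp add: superbr_def signed_diff algebra_simps)

lemma superbr_diff_right: "superbr n y (z - z') = superbr n y z - superbr n y z'"
  by (simp add: superbr_def signed_diff algebra_simps)

lemma superbr_signed: "superbr n (signed k y) z = signed k (superbr n y z)" "superbr n y (signed k z) = signed k (superbr n y z)"
  by (simp_all add: superbr_def signed_diff add.commute)

text \<open>Super Jacobi identity for an odd \<open>d\<close>, \<open>y\<close> of parity
  \<open>n\<close> and \<open>z\<close> of parity \<open>m + 1\<close>: the term with the bracket of
  \<open>d\<close> and \<open>y\<close> vanishes, so bracketing with \<open>y\<close> passes through
  \<open>d\<close> at the cost of (-1)^n.\<close>

lemma super_Jacobi_commuting:
  assumes "superbr n d y = 0"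
  shows "superbr (n * m) y (superbr (m + 1) d z) = signed n (superbr (n + m + 1) d (superbr (n * (m + 1)) y z))"
proof -
  have yD: "y * d = signed n (d * y)"
    using assms by (simp add: superbr_def signed_def split: if_splits)
  have *: "y * (d * w) = signed n (d * (y * w))" for w
    by (metis yD mult.assoc signed_mult(1))
  show ?thesis
  proof (cases "even n")
    case n: True
    then have r: "y * d = d * y" "\<And>w. y * (d * w) = d * (y * w)"
      using yD * by (simp_all add: signed_def)
    show ?thesis
      by (cases "even m") (use n in \<open>simp_all add: superbr_def signed_def algebra_simps r\<close>)
  next
    case n: False
    then have r: "y * d = - (d * y)" "\<And>w. y * (d * w) = - (d * (y * w))"
      using yD * by (simp_all add: signed_def)
    show ?thesis
      by (cases "even m") (use n in \<open>simp_all add: superbr_def signed_def algebra_simps r\<close>)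
  qed
qed

text \<open>For odd \<open>d\<close> the two mixed terms d y d cancel, which leaves the ordinary
  commutator of \<open>y\<close> with the square of \<open>d\<close>.\<close>

lemma superbr_twice: "superbr n d (superbr (Suc n) d y) = d * d * y - y * (d * d)"
  by (cases "even n") (simp_all add: superbr_def signed_def algebra_simps)

text \<open>Super Jacobi again, now with \<open>y\<close> (parity \<open>n + 1\<close>) and
  \<open>f\<close> (parity \<open>m\<close>) supercommuting: \<open>f\<close> acts on
  \<open>d\<close> alone, and \<open>q\<close> is the bracket of \<open>d\<close> with
  \<open>f\<close>.\<close>

lemma superbr_of_superbr:
  assumes DF: "d * f = signed m (f * d) + q" and XF: "y * f = signed ((n + 1) * m) (f * y)"
  shows "superbr (n * m) (superbr (n + 1) d y) f = signed ((n + 1) * m) (superbr ((n + 1) * (m + 1)) q y)"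
proof -
  have *: "y * (f * w) = signed ((n + 1) * m) (f * (y * w))" for w
    using XF by (metis mult.assoc signed_mult(1))
  have **: "d * (f * w) = signed m (f * (d * w)) + q * w" for w
    using DF by (metis distrib_right mult.assoc signed_mult(1))
  show ?thesis
    by (cases "even n"; cases "even m") (simp_all add: superbr_def signed_def algebra_simps DF XF * **)
qed
text \<open>The terms at (i, j) and (j, i) cancel. Exchanging the names of the indices would only
  show that twice the sum is zero, which is weaker in a group that may have 2-torsion; the induction
  cancels the pairs themselves.\<close>

lemma sum_antisym:
  fixes f :: "'i \<Rightarrow> 'i \<Rightarrow> 'a::ab_group_add"
  assumes "finite A" "\<And>i j. \<lbrakk>i \<in> A; j \<in> A; i \<noteq> j\<rbrakk> \<Longrightarrow> f i j = - f j i"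
  shows "(\<Sum>i\<in>A. \<Sum>j\<in>A - {i}. f i j) = 0"
  using assms
proof (induction A)
  case (insert a A)
  have *: "(\<Sum>j\<in>insert a A - {i}. f i j) = f i a + (\<Sum>j\<in>A - {i}. f i j)" if "i \<in> A" for i
  proof -
    have "insert a A - {i} = insert a (A - {i})" using that insert.hyps by auto
    then show ?thesis using insert.hyps by simp
  qed
  have **: "(\<Sum>j\<in>insert a A - {a}. f a j) = (\<Sum>j\<in>A. - f j a)"
    by (rule sum.cong) (use insert.hyps insert.prems in auto)
  have "(\<Sum>i\<in>insert a A. \<Sum>j\<in>insert a A - {i}. f i j) =
      (\<Sum>j\<in>insert a A - {a}. f a j) + (\<Sum>i\<in>A. \<Sum>j\<in>insert a A - {i}. f i j)"
    by (rule sum.insert) (use insert.hyps in auto)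
  also have "\<dots> = (\<Sum>j\<in>A. - f j a) + (\<Sum>i\<in>A. f i a + (\<Sum>j\<in>A - {i}. f i j))"
    by (simp only: ** * cong: sum.cong)
  also have "\<dots> = (\<Sum>i\<in>A. \<Sum>j\<in>A - {i}. f i j)"
    by (simp only: sum.distrib sum_negf minus_add_cancel)
  also have "\<dots> = 0"
    by (rule insert.IH, rule insert.prems) simp_all
  finally show ?case .
qed simp

lemma sum_off_diagonal_swap:
  fixes f :: "'i \<Rightarrow> 'i \<Rightarrow> 'a::ab_group_add"
  assumes "finite A"
  shows "(\<Sum>i\<in>A. \<Sum>j\<in>A - {i}. f i j) = (\<Sum>j\<in>A. \<Sum>i\<in>A - {j}. f i j)"
proof -
  have "A - {i} = {j \<in> A. i \<noteq> j}" "A - {i} = {j \<in> A. j \<noteq> i}" for i by auto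
  then show ?thesis using sum.swap_restrict[OF assms assms, of f "(\<noteq>)"] by simp
qed

section \<open>Symmetries of the Dirac operator\<close>

text \<open>
  The element \<open>u\<close> is the image of the unit under a non-unital embedding, \<open>h\<close> is one half of the sum of
  the \<open>p\<^sub>i\<^sup>2\<close>, and the sign \<open>\<epsilon>\<close> is \<open>(-1)^k\<close>.
\<close>

locale xp_clifford =
  fixes x p e :: "'i \<Rightarrow> 'a::ring" and h u :: 'a and I :: "'i set" and k :: nat
  assumes finI [simp]: "finite I"
    and xx: "\<lbrakk>i \<in> I; j \<in> I\<rbrakk> \<Longrightarrow> x i * x j = x j * x i"
    and pp: "\<lbrakk>i \<in> I; j \<in> I\<rbrakk> \<Longrightarrow> p i * p j = p j * p i"
    and ex: "\<lbrakk>i \<in> I; j \<in> I\<rbrakk> \<Longrightarrow> e i * x j = x j * e i"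
    and ep: "\<lbrakk>i \<in> I; j \<in> I\<rbrakk> \<Longrightarrow> e i * p j = p j * e i"
    and ee: "\<lbrakk>i \<in> I; j \<in> I; i \<noteq> j\<rbrakk> \<Longrightarrow> e i * e j = - (e j * e i)"
    and e2: "i \<in> I \<Longrightarrow> e i * e i = signed k u"
    and h2: "h + h = (\<Sum>i\<in>I. p i * p i)"
    and hx: "j \<in> I \<Longrightarrow> h * x j - x j * h = p j"
    and u_x: "i \<in> I \<Longrightarrow> u * x i = x i" "i \<in> I \<Longrightarrow> x i * u = x i"
    and u_p: "i \<in> I \<Longrightarrow> u * p i = p i" "i \<in> I \<Longrightarrow> p i * u = p i"
    and u_e: "i \<in> I \<Longrightarrow> u * e i = e i" "i \<in> I \<Longrightarrow> e i * u = e i"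
    and u_u: "u * u = u"
begin

definition C :: "'i \<Rightarrow> 'i \<Rightarrow> 'a" where
  "C i j = p i * x j - x j * p i"

text \<open>By the Leibniz rule the commutator of \<open>h\<close> with x_i x_j is p_i x_j + x_i
  p_j. As x_i x_j = x_j x_i, this expression is symmetric in i and j, which rearranges to the
  claim.\<close>

lemma C_sym:
  assumes "i \<in> I" "j \<in> I"
  shows "C i j = C j i"
proof -
  have "h * (x i * x j) - (x i * x j) * h = p i * x j + x i * p j" if "i \<in> I" "j \<in> I" for i j
    using that by (simp add: hx[symmetric] algebra_simps)
  from this[of i j] this[of j i] show ?thesis
    using assms by (simp add: C_def xx algebra_simps)
qed

lemma C_e: "\<lbrakk>i \<in> I; j \<in> I; l \<in> I\<rbrakk> \<Longrightarrow> e l * C i j = C i j * e l"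
  unfolding C_def right_diff_distrib left_diff_distrib
  by (metis (no_types, lifting) ex ep mult.assoc)

definition D :: 'a where
  "D = (\<Sum>i\<in>I. e i * p i)"

text \<open>The cross terms cancel because the e's anticommute while the p's commute; the diagonal
  terms contribute the squares of the e's. So the square of \<open>D\<close> is a sign times
  \<open>h + h\<close>, whose commutators with the x's are known.\<close>

lemma D_square: "D * D = signed k (\<Sum>i\<in>I. p i * p i)"
proof -
  have "D * D = (\<Sum>i\<in>I. \<Sum>j\<in>I. (e i * p i) * (e j * p j))"
    by (simp add: D_def sum_product)
  also have "\<dots> = (\<Sum>i\<in>I. (e i * p i) * (e i * p i) + (\<Sum>j\<in>I - {i}. (e i * p i) * (e j * p j)))"
    by (intro sum.cong refl) (simp add: sum.remove)
  also have "\<dots> = (\<Sum>i\<in>I. (e i * p i) * (e i * p i)) + (\<Sum>i\<in>I. \<Sum>j\<in>I - {i}. (e i * p i) * (e j * p j))"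
    by (simp add: sum.distrib)
  also have "(\<Sum>i\<in>I. \<Sum>j\<in>I - {i}. (e i * p i) * (e j * p j)) = 0"
  proof (rule sum_antisym)
    fix i j assume ij: "i \<in> I" "j \<in> I" "i \<noteq> j"
    have "(e i * p i) * (e j * p j) = (e i * e j) * (p i * p j)" if "i \<in> I" "j \<in> I" for i j
      using that by (metis ep mult.assoc)
    then show "(e i * p i) * (e j * p j) = - ((e j * p j) * (e i * p i))"
      using ij by (simp add: ee[of i j] pp[of i j])
  qed simp
  also have "(\<Sum>i\<in>I. (e i * p i) * (e i * p i)) = (\<Sum>i\<in>I. signed k (p i * p i))"
  proof (rule sum.cong[OF refl])
    fix i assume i: "i \<in> I"
    have "(e i * p i) * (e i * p i) = (e i * e i) * p i * p i"
      using i by (metis ep mult.assoc)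
    then show "(e i * p i) * (e i * p i) = signed k (p i * p i)"
      using i by (simp add: e2 u_p)
  qed
  finally show ?thesis by (simp add: signed_sum)
qed

definition x_vec :: "'i set \<Rightarrow> 'a" where
  "x_vec S = (\<Sum>s\<in>S. x s * e s)"

text \<open>Twice the operator \<open>O\<close>, which avoids dividing by 2.\<close>

definition dblO :: "'i set \<Rightarrow> 'a \<Rightarrow> 'a" where
  "dblO S E = D * x_vec S * E - E * x_vec S * D - signed k E"

text \<open>\<open>E\<close> has the commutation behaviour of \<open>e\<^sub>A\<close> for any list \<open>A\<close> with underlying set \<open>S\<close>.\<close>

definition cliff :: "'i set \<Rightarrow> 'a \<Rightarrow> bool" where
  "cliff S E \<longleftrightarrow> S \<subseteq> I \<and> (\<forall>i\<in>I. x i * E = E * x i \<and> p i * E = E * p i \<and>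
      e i * E = signed (card S + (if i \<in> S then 1 else 0)) (E * e i))"

lemma cliffD:
  assumes "cliff S E"
  shows "S \<subseteq> I" "finite S" "i \<in> I \<Longrightarrow> x i * E = E * x i" "i \<in> I \<Longrightarrow> p i * E = E * p i"
    "i \<in> S \<Longrightarrow> e i * E = signed (card S + 1) (E * e i)"
    "i \<in> I - S \<Longrightarrow> e i * E = signed (card S) (E * e i)"
  using assms finite_subset[OF _ finI, of S] by (auto simp: cliff_def)

lemma cliff_C:
  assumes "cliff S E" "i \<in> I" "j \<in> I"
  shows "C i j * E = E * C i j"
proof -
  have "p i * x j * E = E * (p i * x j)" "x j * p i * E = E * (x j * p i)"
    using cliffD(3)[OF assms(1,3)] cliffD(4)[OF assms(1,2)] by (metis mult.assoc)+
  then show ?thesis by (simp only: C_def left_diff_distrib right_diff_distrib)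
qed

lemma cliff_u: "cliff {} u"
  by (simp add: cliff_def u_x u_p u_e signed_def)

lemma cliff_e: "s \<in> I \<Longrightarrow> cliff {s} (e s)"
  unfolding cliff_def
proof (intro conjI ballI)
  fix i assume "s \<in> I" and i: "i \<in> I"
  then show "x i * e s = e s * x i" "p i * e s = e s * p i"
    using ex[of s i] ep[of s i] by simp_all
  show "e i * e s = signed (card {s} + (if i \<in> {s} then 1 else 0)) (e s * e i)"
    using ee[OF i \<open>s \<in> I\<close>] by (cases "i = s") (simp_all only: signed_def, simp_all)
qed simp

text \<open>In the sign exponents both the cardinality of the set and the membership indicator are
  additive modulo 2 under symmetric difference.\<close>

lemma cliff_mult:
  assumes "cliff S E" "cliff T F"
  shows "cliff ((S \<union> T) - (S \<inter> T)) (E * F)"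
  unfolding cliff_def
proof (intro conjI ballI)
  note c = cliffD[OF assms(1)] and d = cliffD[OF assms(2)]
  let ?U = "(S \<union> T) - (S \<inter> T)"
  show "?U \<subseteq> I" using c(1) d(1) by auto
  fix i assume i: "i \<in> I"
  show "x i * (E * F) = E * F * x i" "p i * (E * F) = E * F * p i"
    using c(3,4)[OF i] d(3,4)[OF i] by (metis mult.assoc)+
  have "card S + card T = card ?U + 2 * card (S \<inter> T)"
  proof -
    have "card ?U = card (S \<union> T) - card (S \<inter> T)"
      using c(2) d(2) by (intro card_Diff_subset) auto
    moreover have "card (S \<inter> T) \<le> card (S \<union> T)"
      using c(2) d(2) by (intro card_mono) auto
    ultimately show ?thesis using card_Un_Int[OF c(2) d(2)] by simp
  qed
  then have cd: "even (card ?U) = even (card S + card T)" by simp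
  have "e i * E = signed (card S + (if i \<in> S then 1 else 0)) (E * e i)"
    and F: "e i * F = signed (card T + (if i \<in> T then 1 else 0)) (F * e i)"
    using assms i by (simp_all add: cliff_def)
  then have "e i * (E * F) = signed (card S + (if i \<in> S then 1 else 0)) (E * (e i * F))"
    by (metis mult.assoc signed_mult(1))
  also have "\<dots> = signed (card S + (if i \<in> S then 1 else 0) + (card T + (if i \<in> T then 1 else 0))) (E * F * e i)"
    by (simp add: F mult.assoc)
  also have "\<dots> = signed (card ?U + (if i \<in> ?U then 1 else 0)) (E * F * e i)"
    by (rule signed_cong) (use cd in auto)
  finally show "e i * (E * F) = signed (card ?U + (if i \<in> ?U then 1 else 0)) (E * F * e i)" .
qed

text \<open>Multiplying by \<open>e s\<close> strikes \<open>s\<close> from the monomial. Phrased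
  through the symmetric difference, this does not require evaluating the square of
  \<open>e s\<close>.\<close>

lemma cliff_remove:
  assumes "cliff S E" "s \<in> S"
  shows "cliff (S - {s}) (e s * E)"
proof -
  have "({s} \<union> S) - ({s} \<inter> S) = S - {s}" using assms(2) by auto
  then show ?thesis
    using cliff_mult[OF cliff_e[of s] assms(1)] cliffD(1)[OF assms(1)] assms(2) by auto
qed

text \<open>All indices in \<open>S\<close> pass \<open>E\<close> with the same sign, so the whole
  vector does. Hence the second product in \<open>dblO\<close> is a signed copy of
  \<open>x_vec S * E * D\<close>, and the difference becomes a supercommutator with
  \<open>D\<close>.\<close>

lemma E_x_vec:
  assumes "cliff S E"
  shows "E * x_vec S = signed (card S + 1) (x_vec S * E)"
  unfolding x_vec_def sum_distrib_left sum_distrib_right signed_sum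
proof (rule sum.cong[OF refl])
  fix s assume s: "s \<in> S"
  then have sI: "s \<in> I" using cliffD(1)[OF assms] by auto
  have "E * (x s * e s) = x s * (E * e s)"
    using cliffD(3)[OF assms sI] by (metis mult.assoc)
  also have "E * e s = signed (card S + 1) (e s * E)"
    by (simp add: cliffD(5)[OF assms s]) (simp add: signed_def)
  finally show "E * (x s * e s) = signed (card S + 1) (x s * e s * E)"
    by (simp add: mult.assoc)
qed

text \<open>For an index outside \<open>S\<close> the vector \<open>e i\<close> passes
  \<open>E\<close> with exactly the sign of the bracket and drops out; for an index in
  \<open>S\<close> the sign is opposite and the term doubles. This serves both for \<open>D\<close>,
  with coefficients \<open>p i\<close>, and for the commutator of \<open>D\<close> with
  \<open>x s\<close>, with coefficients \<open>C i s\<close>.\<close>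

lemma superbr_vector_cliff:
  assumes "cliff S E" and c: "\<And>i. i \<in> I \<Longrightarrow> c i * E = E * c i" "\<And>i. i \<in> I \<Longrightarrow> e i * c i = c i * e i"
  shows "superbr (card S) (\<Sum>i\<in>I. e i * c i) E = (\<Sum>i\<in>S. c i * e i * E + c i * e i * E)"
proof -
  have "superbr (card S) (\<Sum>i\<in>I. e i * c i) E = (\<Sum>i\<in>I. superbr (card S) (e i * c i) E)"
    by (simp add: superbr_sum_left)
  also have "\<dots> = (\<Sum>i\<in>I. if i \<in> S then c i * e i * E + c i * e i * E else 0)"
  proof (rule sum.cong[OF refl])
    fix i assume i: "i \<in> I"
    have "E * (e i * c i) = c i * (E * e i)"
      using c[OF i] by (metis mult.assoc)
    also have "E * e i = signed (card S + (if i \<in> S then 1 else 0)) (e i * E)"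
      using assms(1) i by (simp add: cliff_def) (simp add: signed_def)
    finally have "E * (e i * c i) = signed (card S + (if i \<in> S then 1 else 0)) (c i * e i * E)"
      by (simp add: mult.assoc)
    then show "superbr (card S) (e i * c i) E = (if i \<in> S then c i * e i * E + c i * e i * E else 0)"
      using c(2)[OF i] by (simp add: superbr_def) (simp add: signed_def)
  qed
  also have "\<dots> = (\<Sum>i\<in>S. c i * e i * E + c i * e i * E)"
    using cliffD(1)[OF assms(1)] by (simp add: sum.If_cases Int_absorb1)
  finally show ?thesis .
qed

lemma superbr_D_cliff:
  assumes "cliff S E"
  shows "superbr (card S) D E = (\<Sum>i\<in>S. p i * e i * E + p i * e i * E)"
  unfolding D_def by (rule superbr_vector_cliff[OF assms]) (simp_all add: cliffD(4)[OF assms] ep)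

lemma dblO_alt:
  assumes "cliff S E"
  shows "dblO S E = superbr (card S + 1) D (x_vec S * E) - signed k E"
  by (simp add: dblO_def superbr_def E_x_vec[OF assms] mult.assoc[symmetric])

lemma D_square_x: "j \<in> I \<Longrightarrow> D * D * x j = x j * (D * D) + signed k (p j + p j)"
proof -
  assume "j \<in> I"
  then have "h * x j = x j * h + p j" by (simp flip: hx)
  then have "(h + h) * x j = x j * (h + h) + (p j + p j)" by (simp add: algebra_simps)
  then show ?thesis by (simp add: D_square flip: h2 signed_add)
qed

lemma D_square_cliff:
  assumes "cliff S E"
  shows "D * D * E = E * (D * D)"
proof -
  have "p i * p i * E = E * (p i * p i)" if "i \<in> I" for i
    using cliffD(4)[OF assms that] by (metis mult.assoc)
  then show ?thesis by (simp add: D_square sum_distrib_left sum_distrib_right)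
qed

text \<open>Bracketing twice with \<open>D\<close> is commuting with \<open>D * D\<close>. This
  square commutes with \<open>e s * E\<close> and turns each \<open>x s\<close> into twice
  \<open>p s\<close> up to the sign \<open>k\<close>; the result is the bracket of \<open>D\<close>
  with \<open>signed k E\<close>, which the last term of \<open>dblO\<close> subtracts.\<close>

lemma superbr_D_dblO:
  assumes "cliff S E"
  shows "superbr (card S) D (dblO S E) = 0"
proof -
  note c = cliffD[OF assms]
  let ?n = "card S" let ?X = "x_vec S * E"
  have e: "D * D * (x s * e s * E) = x s * e s * E * (D * D) + signed k (p s * e s * E + p s * e s * E)"
    if s: "s \<in> S" for s
  proof -
    have sI: "s \<in> I" using s c(1) by auto
    have "D * D * (x s * e s * E) = (D * D * x s) * (e s * E)" by (simp add: mult.assoc)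
    also have "\<dots> = x s * (D * D * (e s * E)) + signed k (p s * e s * E + p s * e s * E)"
      unfolding D_square_x[OF sI] by (simp add: distrib_right mult.assoc)
    also have "D * D * (e s * E) = (e s * E) * (D * D)"
      by (rule D_square_cliff[OF cliff_remove[OF assms s]])
    finally show ?thesis by (simp add: mult.assoc)
  qed
  have "D * D * ?X - ?X * (D * D) = signed k (superbr ?n D E)"
    unfolding x_vec_def sum_distrib_left sum_distrib_right superbr_D_cliff[OF assms] signed_sum
      sum_subtractf[symmetric]
    by (intro sum.cong refl) (simp add: e)
  moreover have "superbr ?n D (dblO S E) = D * D * ?X - ?X * (D * D) - signed k (superbr ?n D E)"
    by (simp add: dblO_alt[OF assms] superbr_diff_right superbr_signed(2) superbr_twice)
  ultimately show ?thesis by simp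
qed

lemma superbr_dblO:
  assumes "cliff S E" "cliff T F"
  shows "superbr (card S * card T) (dblO S E) (dblO T F) =
    signed (card S) (superbr (card S + card T + 1) D (superbr (card S * (card T + 1)) (dblO S E) (x_vec T * F)))
      - signed k (superbr (card S * card T) (dblO S E) F)"
  by (simp only: dblO_alt[OF assms(2)] superbr_diff_right superbr_signed(2) super_Jacobi_commuting[OF superbr_D_dblO[OF assms(1)]])

section \<open>Brackets of the operators for two disjoint index sets\<close>

text \<open>
  \<open>V\<close> and \<open>W\<close> are the coefficients of \<open>E F\<close> in the supercommutators of \<open>dblO S E\<close> with \<open>F\<close> and with
  \<open>x_vec T * F\<close> when \<open>S\<close> and \<open>T\<close> are disjoint.
\<close>

definition V :: "'i set \<Rightarrow> 'i set \<Rightarrow> 'a" where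
  "V S T = (\<Sum>s\<in>S. \<Sum>t\<in>T. C t s * e t * e s)"

text \<open>The double commutator [[D, x_s], x_t].\<close>

definition G :: "'i \<Rightarrow> 'i \<Rightarrow> 'a" where
  "G s t = (\<Sum>j\<in>I. e j * (C j s * x t - x t * C j s))"

definition W :: "'i set \<Rightarrow> 'i set \<Rightarrow> 'a" where
  "W S T = (\<Sum>s\<in>S. \<Sum>t\<in>T. G s t * e t * e s
      + (\<Sum>j\<in>T - {t}. x t * C j s * e j * e t * e s + x t * C j s * e j * e t * e s)
      + (\<Sum>i\<in>S - {s}. x s * C i t * e i * e t * e s + x s * C i t * e i * e t * e s))"

end

text \<open>\<open>cliff\<close> only records how \<open>E\<close> and \<open>F\<close> commute with
  the generators, so the sign between \<open>E\<close> and \<open>F\<close> themselves is a separate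
  assumption. It is the sign of two monomials without a common index.\<close>

locale cliff_pair = xp_clifford x p e h u I k
  for x p e :: "'i \<Rightarrow> 'a::ring" and h u I k +
  fixes S T :: "'i set" and E F :: 'a
  assumes S: "cliff S E" and T: "cliff T F" and ST: "S \<inter> T = {}"
    and EF: "E * F = signed (card S * card T) (F * E)"
begin

abbreviation "n \<equiv> card S"
abbreviation "m \<equiv> card T"

lemmas cS = cliffD[OF S] and cT = cliffD[OF T]

lemma mem: "s \<in> S \<Longrightarrow> s \<in> I" "t \<in> T \<Longrightarrow> t \<in> I" "s \<in> S \<Longrightarrow> s \<notin> T" "t \<in> T \<Longrightarrow> t \<notin> S"
  using cS(1) cT(1) ST by auto

lemma FE: "F * E = signed (n * m) (E * F)"
  by (simp add: EF) (simp add: signed_def)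

lemma eF: "s \<in> S \<Longrightarrow> F * e s = signed m (e s * F)"
  using cT(6)[of s] mem by (simp add: signed_def)

lemma eE: "t \<in> T \<Longrightarrow> E * e t = signed n (e t * E)"
  using cS(6)[of t] mem by (simp add: signed_def)

lemma F_eE: "s \<in> S \<Longrightarrow> F * (e s * E) = signed ((n + 1) * m) (e s * (E * F))"
proof -
  assume s: "s \<in> S"
  have "F * (e s * E) = signed m (e s * (F * E))" using eF[OF s] by (metis mult.assoc signed_mult(1))
  then show ?thesis by (simp add: FE algebra_simps)
qed

lemma E_eF: "t \<in> T \<Longrightarrow> E * (e t * F) = signed n (e t * (E * F))"
  using eE by (metis mult.assoc signed_mult(1))

lemma eE_eF:
  assumes "s \<in> S" "t \<in> T"
  shows "e s * E * (e t * F) = signed (n + 1) (e t * (e s * (E * F)))"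
proof -
  have "e s * E * (e t * F) = signed n (e s * e t * (E * F))"
    using assms by (simp add: mult.assoc E_eF)
  also have "e s * e t = - (e t * e s)"
    using assms mem by (intro ee) auto
  finally show ?thesis by (simp add: mult.assoc)
qed

lemma eF_eE:
  assumes "s \<in> S" "t \<in> T"
  shows "e t * F * (e s * E) = signed ((n + 1) * m) (e t * (e s * (E * F)))"
  using assms by (simp add: mult.assoc F_eE)

text \<open>\<open>x_vec S * E\<close> supercommutes with \<open>F\<close>, so Jacobi lets
  \<open>F\<close> act on \<open>D\<close> only. The bracket of \<open>D\<close> with
  \<open>F\<close> is twice the sum of the \<open>p t * e t * F\<close>, which is why
  \<open>V\<close> occurs twice, and bracketing this with \<open>x s * e s * E\<close> leaves the
  commutator of \<open>p t\<close> with \<open>x s\<close>.\<close>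

lemma superbr_dblO_F: "superbr (n * m) (dblO S E) F = V S T * E * F + V S T * E * F"
proof -
  let ?X = "x_vec S * E"
  define Q where "Q = superbr m D F"
  have DF: "D * F = signed m (F * D) + Q" by (simp add: Q_def superbr_def)
  have XF: "?X * F = signed ((n + 1) * m) (F * ?X)"
    unfolding x_vec_def sum_distrib_left sum_distrib_right signed_sum
  proof (rule sum.cong[OF refl])
    fix s assume s: "s \<in> S"
    have "F * (x s * e s * E) = x s * (F * (e s * E))"
      using cT(3)[OF mem(1)[OF s]] by (metis mult.assoc)
    then show "x s * e s * E * F = signed ((n + 1) * m) (F * (x s * e s * E))"
      by (simp add: F_eE[OF s] mult.assoc) (simp add: signed_def)
  qed
  \<comment> \<open>The summand \<open>signed k E\<close> of \<open>dblO\<close> disappears because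
    \<open>E\<close> and \<open>F\<close> supercommute.\<close>
  have "superbr (n * m) (dblO S E) F = superbr (n * m) (superbr (n + 1) D ?X) F"
    by (simp add: dblO_alt[OF S] superbr_diff_left superbr_signed) (simp add: superbr_def EF signed_def)
  also have "\<dots> = signed ((n + 1) * m) (superbr ((n + 1) * (m + 1)) Q ?X)"
    by (rule superbr_of_superbr[OF DF XF])
  also have "superbr ((n + 1) * (m + 1)) Q ?X =
      (\<Sum>t\<in>T. \<Sum>s\<in>S. superbr ((n + 1) * (m + 1)) (p t * e t * F) (x s * e s * E)
         + superbr ((n + 1) * (m + 1)) (p t * e t * F) (x s * e s * E))"
    by (simp only: Q_def superbr_D_cliff[OF T] x_vec_def sum_distrib_right superbr_sum_left superbr_sum_right[of _ "p _ * e _ * F"]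
        superbr_add_left sum.distrib)
  also have "\<dots> = (\<Sum>t\<in>T. \<Sum>s\<in>S. signed ((n + 1) * m) (C t s * e t * e s * (E * F) + C t s * e t * e s * (E * F)))"
  proof (intro sum.cong refl)
    fix t s assume t: "t \<in> T" and s: "s \<in> S"
    have 1: "p t * e t * F * (x s * e s * E) = p t * x s * (e t * F * (e s * E))"
      using cT(3)[OF mem(1)[OF s]] ex[OF mem(2)[OF t] mem(1)[OF s]] by (metis mult.assoc)
    have 2: "x s * e s * E * (p t * e t * F) = x s * p t * (e s * E * (e t * F))"
      using cS(4)[OF mem(2)[OF t]] ep[OF mem(1)[OF s] mem(2)[OF t]] by (metis mult.assoc)
    \<comment> \<open>The sign of the bracket and those of the two reordered monomials agree modulo
      2, so only \<open>p t * x s - x s * p t\<close> is left.\<close>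
    have "superbr ((n + 1) * (m + 1)) (p t * e t * F) (x s * e s * E)
      = signed ((n + 1) * m) (C t s * e t * e s * (E * F))"
      unfolding superbr_def 1 2 eF_eE[OF s t] eE_eF[OF s t] C_def
      by (cases "even n"; cases "even m") (simp_all add: signed_def algebra_simps)
    then show "superbr ((n + 1) * (m + 1)) (p t * e t * F) (x s * e s * E)
         + superbr ((n + 1) * (m + 1)) (p t * e t * F) (x s * e s * E)
      = signed ((n + 1) * m) (C t s * e t * e s * (E * F) + C t s * e t * e s * (E * F))"
      by (simp only: signed_add)
  qed
  also have "\<dots> = signed ((n + 1) * m) (V S T * (E * F) + V S T * (E * F))"
    unfolding V_def by (subst sum.swap) (simp add: sum_distrib_right signed_sum sum.distrib signed_add)
  finally show ?thesis by (simp add: mult.assoc) (simp add: signed_def)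
qed


text \<open>Moving \<open>D\<close> past \<open>x s\<close> splits \<open>dblO\<close> into terms
  with [D, x_s], called \<open>\<gamma> s\<close>, and terms with \<open>Q s\<close>, the bracket of
  \<open>D\<close> with \<open>e s * E\<close>. Against \<open>x t * e t * F\<close> the former give
  \<open>G s t\<close> (from \<open>x t\<close>) and the sum over \<open>T - {t}\<close> (from
  \<open>e t * F\<close>). The latter give the sum over \<open>S - {s}\<close>, since
  \<open>e s * E\<close> is a monomial on that set.\<close>

lemma superbr_dblO_x_vec: "superbr (n * (m + 1)) (dblO S E) (x_vec T * F) = signed (n + 1) (W S T * (E * F))"
proof -
  define \<gamma> where "\<gamma> s = (\<Sum>j\<in>I. e j * C j s)" for s
  define Q where "Q s = superbr (n + 1) D (e s * E)" for s
  have D_x: "D * x s = \<gamma> s + x s * D" if "s \<in> I" for s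
    unfolding D_def \<gamma>_def sum_distrib_left sum_distrib_right sum.distrib[symmetric]
  proof (rule sum.cong[OF refl])
    fix j assume "j \<in> I"
    then have "x s * (e j * p j) = e j * (x s * p j)"
      using ex[of j s] that by (metis mult.assoc)
    then show "e j * p j * x s = e j * C j s + x s * (e j * p j)"
      by (simp add: C_def algebra_simps)
  qed
  have G_\<gamma>: "\<gamma> s * x t = G s t + x t * \<gamma> s" if "s \<in> I" "t \<in> I" for s t
    unfolding G_def \<gamma>_def sum_distrib_left sum_distrib_right sum.distrib[symmetric]
  proof (rule sum.cong[OF refl])
    fix j assume "j \<in> I"
    then have "x t * (e j * C j s) = e j * (x t * C j s)"
      using ex[of j t] that by (metis mult.assoc)
    then show "e j * C j s * x t = e j * (C j s * x t - x t * C j s) + x t * (e j * C j s)"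
      by (simp add: algebra_simps)
  qed
  \<comment> \<open>Brackets with \<open>e s * E\<close> naturally carry the cardinality of a set
    with one element removed; the exponent increased by one has the same parity and avoids truncated
    subtraction.\<close>
  have card1: "signed (card (S' - {s})) y = signed (card S' + 1) y" if "s \<in> S'" "finite S'" for S' s and y :: 'a
  proof (rule signed_cong)
    have "card S' + 1 = card (S' - {s}) + 2" using card.remove[OF that(2,1)] by linarith
    then show "even (card (S' - {s})) = even (card S' + 1)" by (simp only: even_add) simp
  qed
  have br1: "superbr (card (S' - {s})) y z = superbr (card S' + 1) y z" if "s \<in> S'" "finite S'" for S' s and y z :: 'a
    unfolding superbr_def card1[OF that] ..
  have dblO_sum: "dblO S E = (\<Sum>s\<in>S. \<gamma> s * (e s * E) + x s * Q s) - signed k E"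
    unfolding dblO_alt[OF S]
  proof (rule arg_cong[where f = "\<lambda>z. z - signed k E"])
    show "superbr (n + 1) D (x_vec S * E) = (\<Sum>s\<in>S. \<gamma> s * (e s * E) + x s * Q s)"
      unfolding x_vec_def sum_distrib_right superbr_sum_right
    proof (rule sum.cong[OF refl])
      fix s assume s: "s \<in> S"
      have "D * (x s * e s * E) = \<gamma> s * (e s * E) + x s * (D * (e s * E))"
        using D_x[OF mem(1)[OF s]] by (metis distrib_right mult.assoc)
      then show "superbr (n + 1) D (x s * e s * E) = \<gamma> s * (e s * E) + x s * Q s"
        by (simp add: superbr_def Q_def mult.assoc right_diff_distrib)
    qed
  qed
  have E_term: "superbr (n * (m + 1)) E (x t * e t * F) = 0" if t: "t \<in> T" for t
  proof -
    have "E * (x t * e t * F) = x t * (E * (e t * F))"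
      using cS(3)[OF mem(2)[OF t]] by (metis mult.assoc)
    also have "\<dots> = signed (n * (m + 1)) (x t * e t * F * E)"
      by (simp add: E_eF[OF t] EF mult.assoc)
    finally show ?thesis by (simp add: superbr_def)
  qed
  have \<gamma>_term: "superbr (n * (m + 1)) (\<gamma> s * (e s * E)) (x t * e t * F) =
      signed (n + 1) ((G s t * e t * e s + (\<Sum>j\<in>T - {t}. x t * C j s * e j * e t * e s
         + x t * C j s * e j * e t * e s)) * (E * F))"
    if s: "s \<in> S" and t: "t \<in> T" for s t
  proof -
    let ?w = "e s * E" and ?v = "e t * F"
    define B where "B = superbr (m + 1) (\<gamma> s) ?v"
    note sI = mem(1)[OF s] and tI = mem(2)[OF t]
    have cT': "cliff (T - {t}) ?v" and cS': "cliff (S - {s}) ?w"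
      by (rule cliff_remove[OF T t], rule cliff_remove[OF S s])
    \<comment> \<open>Only indices of \<open>T - {t}\<close> survive, because \<open>?v\<close>
      behaves like a monomial on that set.\<close>
    have B: "B = (\<Sum>j\<in>T - {t}. C j s * e j * ?v + C j s * e j * ?v)"
      unfolding B_def br1[OF t cT(2), symmetric] \<gamma>_def
      by (rule superbr_vector_cliff[OF cT']) (simp_all add: cliff_C[OF cT'] C_e sI)
    have \<gamma>v: "\<gamma> s * ?v = signed (m + 1) (?v * \<gamma> s) + B"
      by (simp add: B_def superbr_def)
    have wv: "?w * ?v = signed ((n + 1) * (m + 1)) (?v * ?w)"
      unfolding eE_eF[OF s t] eF_eE[OF s t] signed_signed
      by (rule signed_cong) (cases "even n"; simp)
    have "\<gamma> s * ?w * (x t * e t * F) = \<gamma> s * x t * (?w * ?v)"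
      using cliffD(3)[OF cS' tI] by (metis mult.assoc)
    also have "\<dots> = G s t * (?w * ?v) + x t * (\<gamma> s * (?w * ?v))"
      by (simp add: G_\<gamma>[OF sI tI] distrib_right mult.assoc)
    also have "\<gamma> s * (?w * ?v) = signed ((n + 1) * (m + 1)) (\<gamma> s * ?v * ?w)"
      unfolding wv by (simp only: signed_mult mult.assoc)
    also have "\<dots> = signed (n * (m + 1)) (?v * \<gamma> s * ?w) + signed ((n + 1) * (m + 1)) (B * ?w)"
      unfolding \<gamma>v by (cases "even n"; cases "even m") (simp_all add: signed_def algebra_simps)
    \<comment> \<open>The product with \<open>?v\<close> moved in front of \<open>\<gamma> s\<close>
      is exactly the second half of the bracket and cancels.\<close>
    finally have "superbr (n * (m + 1)) (\<gamma> s * ?w) (x t * e t * F)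
        = G s t * (?w * ?v) + signed ((n + 1) * (m + 1)) (x t * (B * ?w))"
      by (simp add: superbr_def distrib_left mult.assoc)
    also have "B * ?w = (\<Sum>j\<in>T - {t}. C j s * e j * (?v * ?w) + C j s * e j * (?v * ?w))"
      unfolding B sum_distrib_right by (simp add: distrib_right mult.assoc)
    finally show ?thesis
      unfolding eE_eF[OF s t] eF_eE[OF s t]
      by (cases "even n"; cases "even m")
        (simp_all add: signed_def algebra_simps sum_distrib_left sum_distrib_right sum_negf sum_subtractf sum.distrib)
  qed
  have Q_term: "superbr (n * (m + 1)) (x s * Q s) (x t * e t * F) =
      signed (n + 1) ((\<Sum>i\<in>S - {s}. x s * C i t * e i * e t * e s
         + x s * C i t * e i * e t * e s) * (E * F))"
    if s: "s \<in> S" and t: "t \<in> T" for s t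
  proof -
    let ?v = "e t * F"
    note sI = mem(1)[OF s] and tI = mem(2)[OF t]
    have cT': "cliff (T - {t}) ?v" and cS': "cliff (S - {s}) (e s * E)"
      by (rule cliff_remove[OF T t], rule cliff_remove[OF S s])
    have "superbr (n * (m + 1)) (x s * Q s) (x t * e t * F) =
       (\<Sum>i\<in>S - {s}. superbr (n * (m + 1)) (x s * (p i * e i * (e s * E))) (x t * e t * F)
         + superbr (n * (m + 1)) (x s * (p i * e i * (e s * E))) (x t * e t * F))"
      unfolding Q_def br1[OF s cS(2), symmetric] superbr_D_cliff[OF cS'] sum_distrib_left
        superbr_sum_left distrib_left superbr_add_left ..
    also have "\<dots> = (\<Sum>i\<in>S - {s}. signed (n + 1) (x s * C i t * e i * e t * e s * (E * F)
        + x s * C i t * e i * e t * e s * (E * F)))"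
    proof (rule sum.cong[OF refl])
      fix i assume i: "i \<in> S - {s}"
      then have iI: "i \<in> I" using mem(1) by auto
      let ?z = "e i * (e s * E)"
      have cZ: "cliff (S - {s} - {i}) ?z" by (rule cliff_remove[OF cS' i])
      have "x s * (p i * e i * (e s * E)) * (x t * e t * F) = x s * p i * (?z * x t) * ?v"
        by (simp add: mult.assoc)
      also have "\<dots> = x s * p i * x t * (e i * (e s * E * ?v))"
        unfolding cliffD(3)[OF cZ tI, symmetric] by (simp only: mult.assoc)
      also have "\<dots> = signed (n + 1) (x s * p i * x t * (e i * (e t * (e s * (E * F)))))"
        by (simp add: eE_eF[OF s t])
      finally have 1: "x s * (p i * e i * (e s * E)) * (x t * e t * F)
        = signed (n + 1) (x s * p i * x t * (e i * (e t * (e s * (E * F)))))" .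
      have "x t * e t * F * (x s * (p i * e i * (e s * E))) = x t * (?v * x s) * p i * ?z"
        by (simp add: mult.assoc)
      also have "\<dots> = x t * x s * (?v * p i) * ?z"
        unfolding cliffD(3)[OF cT' sI, symmetric] by (simp only: mult.assoc)
      \<comment> \<open>Commuting the two x's brings \<open>x s\<close> to the front as in the other
        product, so that the difference factors as \<open>x s * C i t\<close>.\<close>
      also have "\<dots> = x s * x t * p i * (?v * ?z)"
        unfolding xx[OF sI tI] cliffD(4)[OF cT' iI, symmetric] by (simp only: mult.assoc)
      also have "?v * ?z = signed (n * m + 1) (e i * (e t * (e s * (E * F))))"
      proof -
        have "?v * ?z = e t * (F * e i) * (e s * E)" by (simp add: mult.assoc)
        also have "\<dots> = signed m (e t * e i * (F * (e s * E)))"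
          using eF[of i] i by (simp add: mult.assoc)
        also have "\<dots> = signed (m + (n + 1) * m) (e t * e i * (e s * (E * F)))"
          by (simp add: F_eE[OF s])
        also have "e t * e i = - (e i * e t)"
          using i mem(3)[of i] t by (intro ee tI iI) auto
        finally show ?thesis by (simp add: mult.assoc) (simp add: signed_def)
      qed
      finally have 2: "x t * e t * F * (x s * (p i * e i * (e s * E)))
        = x s * x t * p i * signed (n * m + 1) (e i * (e t * (e s * (E * F))))" .
      have "superbr (n * (m + 1)) (x s * (p i * e i * (e s * E))) (x t * e t * F)
        = signed (n + 1) (x s * C i t * e i * e t * e s * (E * F))"
        unfolding superbr_def 1 2 C_def
        by (cases "even n"; cases "even m") (simp_all add: signed_def algebra_simps)
      then show "superbr (n * (m + 1)) (x s * (p i * e i * (e s * E))) (x t * e t * F)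
         + superbr (n * (m + 1)) (x s * (p i * e i * (e s * E))) (x t * e t * F)
         = signed (n + 1) (x s * C i t * e i * e t * e s * (E * F)
        + x s * C i t * e i * e t * e s * (E * F))"
        by (simp only: signed_add)
    qed
    finally show ?thesis by (simp add: signed_sum sum_distrib_right distrib_right)
  qed
  have "superbr (n * (m + 1)) (dblO S E) (x_vec T * F) =
      (\<Sum>s\<in>S. \<Sum>t\<in>T. superbr (n * (m + 1)) (\<gamma> s * (e s * E)) (x t * e t * F)
         + superbr (n * (m + 1)) (x s * Q s) (x t * e t * F))"
  proof -
    have "superbr (n * (m + 1)) (dblO S E) (x t * e t * F) =
        (\<Sum>s\<in>S. superbr (n * (m + 1)) (\<gamma> s * (e s * E)) (x t * e t * F)
         + superbr (n * (m + 1)) (x s * Q s) (x t * e t * F))" if "t \<in> T" for t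
      by (simp only: dblO_sum superbr_diff_left superbr_sum_left superbr_add_left superbr_signed E_term[OF that] signed_zero diff_zero)
    then show ?thesis
      by (subst sum.swap) (simp only: x_vec_def sum_distrib_right superbr_sum_right cong: sum.cong)
  qed
  also have "\<dots> = signed (n + 1) (W S T * (E * F))"
    unfolding W_def sum_distrib_right[of _ _ "E * F"] signed_sum
    by (intro sum.cong refl) (simp only: \<gamma>_term Q_term signed_add[symmetric] distrib_right[symmetric])
  finally show ?thesis .
qed

text \<open>On the right \<open>E\<close> and \<open>F\<close> enter only through
  \<open>E * F\<close>, and the exponents only through \<open>n + m\<close>. Pairs that share these
  data can therefore be compared by \<open>V\<close> and \<open>W\<close> alone.\<close>

lemma superbr_dblO_dblO:
  "superbr (n * m) (dblO S E) (dblO T F) =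
    - superbr (n + m + 1) D (W S T * (E * F)) - signed k (V S T * (E * F) + V S T * (E * F))"
proof -
  have "signed n (superbr (n + m + 1) D (signed (n + 1) (W S T * (E * F)))) = - superbr (n + m + 1) D (W S T * (E * F))"
    by (simp add: superbr_signed) (simp add: signed_def)
  then show ?thesis
    by (simp add: superbr_dblO[OF S T] superbr_dblO_x_vec[simplified] superbr_dblO_F mult.assoc)
qed

end

section \<open>Additivity of the coefficients and summation over the first list\<close>

context xp_clifford
begin

lemma V_sum:
  assumes "finite A" "finite B" "A \<union> B \<subseteq> I" "A \<inter> B = {}"
  shows "V A B = (\<Sum>a\<in>A. V {a} (A \<union> B - {a}))"
proof -
  have "V {a} (A \<union> B - {a}) = (\<Sum>t\<in>A - {a}. C t a * e t * e a) + (\<Sum>t\<in>B. C t a * e t * e a)"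
    if "a \<in> A" for a
  proof -
    have "A \<union> B - {a} = (A - {a}) \<union> B" using that assms(4) by auto
    then show ?thesis
      using assms by (simp add: V_def) (rule sum.union_disjoint, auto)
  qed
  moreover have "(\<Sum>a\<in>A. \<Sum>t\<in>A - {a}. C t a * e t * e a) = 0"
  proof (rule sum_antisym[OF assms(1)])
    fix a t assume "a \<in> A" "t \<in> A" "a \<noteq> t"
    then have "e t * e a = - (e a * e t)" "C t a = C a t"
      using assms(3) by (auto intro!: ee C_sym)
    then show "C t a * e t * e a = - (C a t * e a * e t)" by (simp add: mult.assoc)
  qed
  ultimately show ?thesis by (simp add: V_def sum.distrib)
qed

text \<open>The triple sums on the right run over a in \<open>A\<close> and distinct t, j in the
  rest of the union. Those with j in \<open>A\<close> cancel by antisymmetry in a and j, whatever t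
  is. Those with t, j in \<open>B\<close> form the second sum in \<open>W A B\<close>. Those with t
  in \<open>A\<close> and j in \<open>B\<close> become its third sum after a cyclic
  relabelling.\<close>

lemma W_sum:
  assumes "finite A" "finite B" "A \<union> B \<subseteq> I" "A \<inter> B = {}"
  shows "W A B = (\<Sum>a\<in>A. W {a} (A \<union> B - {a}))"
proof -
  define f where "f a t = G a t * e t * e a" for a t
  define g where "g a t j = x t * C j a * e j * e t * e a + x t * C j a * e j * e t * e a" for a t j
  \<comment> \<open>Jacobi: [[p_j, x_a], x_t] - [[p_j, x_t], x_a] = [p_j, [x_a, x_t]] = 0.\<close>
  have G_sym: "G a t = G t a" if "a \<in> I" "t \<in> I" for a t
    unfolding G_def
  proof (rule sum.cong[OF refl])
    fix j assume j: "j \<in> I"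
    have "C j a * x t - x t * C j a = C j t * x a - x a * C j t"
    proof -
      have 1: "x a * (x t * p j) = x t * (x a * p j)"
        using xx[OF that] by (metis mult.assoc)
      show ?thesis using xx[OF that] 1 by (simp add: C_def algebra_simps)
    qed
    then show "e j * (C j a * x t - x t * C j a) = e j * (C j t * x a - x a * C j t)" by simp
  qed
  have f_anti: "f a t = - f t a" if "a \<in> I" "t \<in> I" "a \<noteq> t" for a t
    using that ee[of t a] by (simp add: f_def G_sym[of a t] mult.assoc)
  \<comment> \<open>Reversing three anticommuting factors takes three transpositions, hence a minus
    sign, while \<open>C j a\<close> is symmetric.\<close>
  have g_anti: "g a t j = - g j t a" if "a \<in> I" "t \<in> I" "j \<in> I" "a \<noteq> t" "a \<noteq> j" "t \<noteq> j" for a t j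
  proof -
    have "e j * (e t * e a) = - (e t * (e j * e a))" using ee[of j t] that by (metis mult.assoc mult_minus_left)
    also have "\<dots> = e t * (e a * e j)" using ee[of j a] that by simp
    also have "\<dots> = - (e a * (e t * e j))" using ee[of t a] that by (metis mult.assoc mult_minus_left)
    finally show ?thesis using C_sym[of j a] that by (simp add: g_def mult.assoc)
  qed
  \<comment> \<open>A cyclic permutation of three anticommuting factors is even, so no sign
    appears.\<close>
  have g_cyc: "x s * C i t * e i * e t * e s + x s * C i t * e i * e t * e s = g i s t"
    if "s \<in> I" "t \<in> I" "i \<in> I" "s \<noteq> t" "s \<noteq> i" "t \<noteq> i" for s t i
  proof -
    have "e i * (e t * e s) = - (e t * (e i * e s))" using ee[of i t] that by (metis mult.assoc mult_minus_left)
    also have "\<dots> = e t * (e s * e i)" using ee[of i s] that by simp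
    finally show ?thesis using C_sym[of i t] that by (simp add: g_def mult.assoc)
  qed
  have U: "(\<Sum>t\<in>A \<union> B - {a}. \<phi> t) = (\<Sum>t\<in>A - {a}. \<phi> t) + (\<Sum>t\<in>B. \<phi> t)"
    if "a \<in> A" for a and \<phi> :: "'i \<Rightarrow> 'a"
  proof -
    have "A \<union> B - {a} = (A - {a}) \<union> B" using that assms(4) by auto
    moreover have "(A - {a}) \<inter> B = {}" using assms(4) by auto
    ultimately show ?thesis using assms by (simp add: sum.union_disjoint)
  qed
  have U1: "(\<Sum>j\<in>A \<union> B - {a} - {t}. \<phi> j) = (\<Sum>j\<in>A - {a} - {t}. \<phi> j) + (\<Sum>j\<in>B. \<phi> j)"
    if "a \<in> A" "t \<in> A" for a t and \<phi> :: "'i \<Rightarrow> 'a"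
  proof -
    have "A \<union> B - {a} - {t} = (A - {a} - {t}) \<union> B" using that assms(4) by auto
    moreover have "(A - {a} - {t}) \<inter> B = {}" using assms(4) by auto
    ultimately show ?thesis using assms by (simp add: sum.union_disjoint)
  qed
  have U2: "(\<Sum>j\<in>A \<union> B - {a} - {t}. \<phi> j) = (\<Sum>j\<in>A - {a}. \<phi> j) + (\<Sum>j\<in>B - {t}. \<phi> j)"
    if "a \<in> A" "t \<in> B" for a t and \<phi> :: "'i \<Rightarrow> 'a"
  proof -
    have "A \<union> B - {a} - {t} = (A - {a}) \<union> (B - {t})" using that assms(4) by auto
    moreover have "(A - {a}) \<inter> (B - {t}) = {}" using assms(4) by auto
    ultimately show ?thesis using assms by (simp add: sum.union_disjoint)
  qed
  have Wa: "W {a} (A \<union> B - {a}) = (\<Sum>t\<in>A - {a}. f a t) + (\<Sum>t\<in>B. f a t)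
      + ((\<Sum>t\<in>A - {a}. \<Sum>j\<in>A - {a} - {t}. g a t j) + (\<Sum>t\<in>A - {a}. \<Sum>j\<in>B. g a t j))
      + ((\<Sum>t\<in>B. \<Sum>j\<in>A - {a}. g a t j) + (\<Sum>t\<in>B. \<Sum>j\<in>B - {t}. g a t j))"
    if a: "a \<in> A" for a
  proof -
    have "W {a} (A \<union> B - {a}) = (\<Sum>t\<in>A \<union> B - {a}. f a t)
        + (\<Sum>t\<in>A \<union> B - {a}. \<Sum>j\<in>A \<union> B - {a} - {t}. g a t j)"
      by (simp add: W_def f_def g_def sum.distrib)
    also have "(\<Sum>t\<in>A \<union> B - {a}. \<Sum>j\<in>A \<union> B - {a} - {t}. g a t j) =
        (\<Sum>t\<in>A - {a}. (\<Sum>j\<in>A - {a} - {t}. g a t j) + (\<Sum>j\<in>B. g a t j))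
        + (\<Sum>t\<in>B. (\<Sum>j\<in>A - {a}. g a t j) + (\<Sum>j\<in>B - {t}. g a t j))"
      unfolding U[OF a]
      by (intro arg_cong2[where f = "(+)"] sum.cong refl) (simp_all only: U1[OF a] U2[OF a] DiffD1)
    finally show ?thesis by (simp only: U[OF a] sum.distrib add.assoc)
  qed
  have 1: "(\<Sum>a\<in>A. \<Sum>t\<in>A - {a}. f a t) = 0"
    by (rule sum_antisym[OF assms(1)]) (use assms(3) in \<open>auto intro!: f_anti\<close>)
  \<comment> \<open>The antisymmetry exchanges the outer and the inner index, so the middle index
    \<open>t\<close> is first made the outermost one.\<close>
  have 2: "(\<Sum>a\<in>A. \<Sum>t\<in>A - {a}. \<Sum>j\<in>A - {a} - {t}. g a t j) = 0"
  proof -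
    have "(\<Sum>a\<in>A - {t}. \<Sum>j\<in>A - {a} - {t}. g a t j) = 0" if "t \<in> A" for t
    proof -
      have "A - {a} - {t} = A - {t} - {a}" for a by auto
      then have "(\<Sum>a\<in>A - {t}. \<Sum>j\<in>A - {a} - {t}. g a t j) = (\<Sum>a\<in>A - {t}. \<Sum>j\<in>A - {t} - {a}. g a t j)"
        by simp
      also have "\<dots> = 0"
        by (rule sum_antisym) (use assms that in \<open>auto intro!: g_anti\<close>)
      finally show ?thesis .
    qed
    then show ?thesis
      by (subst sum_off_diagonal_swap[OF assms(1)]) simp
  qed
  have 3: "(\<Sum>a\<in>A. \<Sum>t\<in>B. \<Sum>j\<in>A - {a}. g a t j) = 0"
  proof -
    have "(\<Sum>a\<in>A. \<Sum>j\<in>A - {a}. g a t j) = 0" if "t \<in> B" for t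
      by (rule sum_antisym[OF assms(1)]) (use assms that in \<open>auto intro!: g_anti\<close>)
    then show ?thesis by (subst sum.swap) simp
  qed
  have 4: "(\<Sum>s\<in>A. \<Sum>t\<in>B. \<Sum>i\<in>A - {s}. x s * C i t * e i * e t * e s + x s * C i t * e i * e t * e s)
      = (\<Sum>a\<in>A. \<Sum>t\<in>A - {a}. \<Sum>j\<in>B. g a t j)" (is "?L = _")
  proof -
    have "?L = (\<Sum>s\<in>A. \<Sum>t\<in>B. \<Sum>i\<in>A - {s}. g i s t)"
      by (intro sum.cong refl g_cyc) (use assms in auto)
    also have "\<dots> = (\<Sum>s\<in>A. \<Sum>i\<in>A - {s}. \<Sum>t\<in>B. g i s t)"
      by (intro sum.cong refl sum.swap)
    also have "\<dots> = (\<Sum>i\<in>A. \<Sum>s\<in>A - {i}. \<Sum>t\<in>B. g i s t)"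
      by (rule sum_off_diagonal_swap[OF assms(1)])
    finally show ?thesis .
  qed
  have "W A B = (\<Sum>s\<in>A. \<Sum>t\<in>B. f s t) + (\<Sum>s\<in>A. \<Sum>t\<in>B. \<Sum>j\<in>B - {t}. g s t j)
      + (\<Sum>s\<in>A. \<Sum>t\<in>B. \<Sum>i\<in>A - {s}. x s * C i t * e i * e t * e s + x s * C i t * e i * e t * e s)"
    unfolding W_def f_def g_def by (simp only: sum.distrib)
  also have "\<dots> = (\<Sum>a\<in>A. W {a} (A \<union> B - {a}))"
    unfolding 4 using Wa 1 2 3 by (simp add: sum.distrib)
  finally show ?thesis .
qed

definition elist :: "'i list \<Rightarrow> 'a" where
  "elist L = foldr (\<lambda>a v. e a * v) L u"

lemma elist_u:
  assumes "set L \<subseteq> I"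
  shows "u * elist L = elist L" "elist L * u = elist L"
  using assms by (induction L) (simp_all add: elist_def u_u u_e mult.assoc[symmetric], simp add: u_e mult.assoc)

lemma cliff_elist:
  assumes "distinct L" "set L \<subseteq> I"
  shows "cliff (set L) (elist L)"
  using assms
proof (induction L)
  case Nil
  then show ?case by (simp add: elist_def cliff_u)
next
  case (Cons a L)
  then have "({a} \<union> set L) - ({a} \<inter> set L) = set (a # L)" by auto
  with cliff_mult[OF cliff_e[of a] Cons.IH] Cons.prems show ?case by (simp add: elist_def)
qed

text \<open>Each letter lies outside \<open>T\<close> and passes \<open>F\<close> with the sign
  (-1)^|T|. The assumptions on \<open>u\<close> settle the empty list, whose product is
  \<open>u\<close> and not a unit of the ring.\<close>

lemma elist_cliff_commute:
  assumes "distinct L" "set L \<subseteq> I" "cliff T F" "set L \<inter> T = {}" "u * F = F" "F * u = F"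
  shows "elist L * F = signed (card (set L) * card T) (F * elist L)"
  using assms(1,2,4)
proof (induction L)
  case Nil
  then show ?case by (simp add: elist_def assms(5,6) signed_def)
next
  case (Cons a L)
  then have "elist L * F = signed (card (set L) * card T) (F * elist L)" by simp
  then have "elist (a # L) * F = signed (card (set L) * card T) (e a * F * elist L)"
    by (simp add: elist_def mult.assoc)
  also have "e a * F = signed (card T) (F * e a)"
    using Cons.prems by (intro cliffD(6)[OF assms(3)]) auto
  finally show ?case
    using Cons.prems by (simp add: elist_def mult.assoc algebra_simps)
qed

lemma supercommutator_sum:
  assumes "distinct A" "set A \<subseteq> I" "distinct B" "set B \<subseteq> I" "set A \<inter> set B = {}"
  shows "superbr (card (set A) * card (set B)) (dblO (set A) (elist A)) (dblO (set B) (elist B)) =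
    signed k (\<Sum>a\<in>set A. superbr (card (set A \<union> set B - {a})) (dblO {a} (elist [a]))
      (dblO (set A \<union> set B - {a}) (elist [a] * (elist A * elist B))))"
proof -
  note u[simp] = elist_u[OF assms(2)] elist_u[OF assms(4)]
  let ?n = "card (set A)" and ?m = "card (set B)" and ?EF = "elist A * elist B"
  interpret AB: cliff_pair x p e h u I k "set A" "set B" "elist A" "elist B"
    using assms by unfold_locales (auto intro!: cliff_elist elist_cliff_commute)
  have summand: "superbr (card (set A \<union> set B - {a})) (dblO {a} (elist [a]))
      (dblO (set A \<union> set B - {a}) (elist [a] * ?EF)) =
      signed k (- superbr (?n + ?m + 1) D (W {a} (set A \<union> set B - {a}) * ?EF)
        - signed k (V {a} (set A \<union> set B - {a}) * ?EF + V {a} (set A \<union> set B - {a}) * ?EF))"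
    if a: "a \<in> set A" for a
  proof -
    let ?T = "set A \<union> set B - {a}"
    have aI: "a \<in> I" using a assms(2) by auto
    have ea: "elist [a] = e a" using aI by (simp add: elist_def u_e)
    have T: "cliff ?T (e a * ?EF)"
    proof -
      have "set A \<union> set B - set A \<inter> set B = set A \<union> set B" using assms(5) by auto
      then show ?thesis
        using cliff_remove[OF cliff_mult[OF AB.S AB.T], of a] a by simp
    qed
    have E: "elist [a] * (e a * ?EF) = signed (card (set [a]) * card ?T) (e a * ?EF * elist [a])"
      using T aI by (intro elist_cliff_commute) (auto simp: mult.assoc, simp add: u_e flip: mult.assoc)
    interpret a: cliff_pair x p e h u I k "{a}" ?T "e a" "e a * ?EF"
      using cliff_e[OF aI] T E ea by unfold_locales auto
    \<comment> \<open>Here the two copies of \<open>e a\<close> meet; the remaining \<open>u\<close>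
      is absorbed by \<open>elist A\<close>.\<close>
    have sq: "e a * (e a * ?EF) = signed k ?EF"
      using e2[OF aI] by (metis mult.assoc signed_mult(1) u(1))
    \<comment> \<open>The two cardinalities for ({a}, \<open>?T\<close>) again add up to
      \<open>?n + ?m\<close>, so the bracket with \<open>D\<close> has the same exponent for every
      \<open>a\<close>.\<close>
    have "card (set A \<union> set B) = ?n + ?m"
      using assms(5) by (simp add: card_Un_disjoint)
    moreover have "card (set A \<union> set B) = Suc (card ?T)"
      using a by (intro card.remove) auto
    ultimately have "card {a} + card ?T + 1 = ?n + ?m + 1" by simp
    then have "superbr (card {a} * card ?T) (dblO {a} (e a)) (dblO ?T (e a * ?EF)) =
        - superbr (?n + ?m + 1) D (W {a} ?T * signed k ?EF) - signed k (V {a} ?T * signed k ?EF + V {a} ?T * signed k ?EF)"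
      using a.superbr_dblO_dblO unfolding sq by simp
    then show ?thesis
      unfolding ea by (simp add: superbr_signed signed_diff signed_add del: signed_signed) (simp add: signed_def)
  qed
  have "superbr (?n * ?m) (dblO (set A) (elist A)) (dblO (set B) (elist B)) =
      (\<Sum>a\<in>set A. - superbr (?n + ?m + 1) D (W {a} (set A \<union> set B - {a}) * ?EF)
        - signed k (V {a} (set A \<union> set B - {a}) * ?EF + V {a} (set A \<union> set B - {a}) * ?EF))"
    unfolding AB.superbr_dblO_dblO
    using assms by (simp add: V_sum[of "set A" "set B"] W_sum[of "set A" "set B"] sum_distrib_right superbr_sum_right
       sum_negf sum_subtractf sum.distrib signed_sum signed_add)
  also have "\<dots> = (\<Sum>a\<in>set A. signed k (superbr (card (set A \<union> set B - {a})) (dblO {a} (elist [a]))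
      (dblO (set A \<union> set B - {a}) (elist [a] * ?EF))))"
    by (rule sum.cong[OF refl]) (simp only: summand, simp add: signed_def)
  finally show ?thesis by (simp add: signed_sum)
qed

end

section \<open>The defining relations in the tensor product\<close>

lemma carrier_ring_of_type_algebra [simp]: "carrier ring_of_type_algebra = UNIV"
  by (simp add: ring_of_type_algebra_def)

text \<open>The ground field is known only up to an abstract isomorphism; transporting 1 + 1 shows
  that 1/2 really is a half in it.\<close>

lemma two_neq_zero_of_ring_iso:
  assumes "(ring_of_type_algebra :: 'a::field ring) \<simeq> (ring_of_type_algebra :: 'b::field_char_0 ring)"
  shows "(2 :: 'a) \<noteq> 0"
proof
  assume "(2 :: 'a) = 0"
  then have "(1 + 1 :: 'a) = 0" by simp
  moreover obtain h where "h \<in> ring_hom (ring_of_type_algebra :: 'a ring) (ring_of_type_algebra :: 'b ring)"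
    using assms by (auto simp: is_ring_iso_def ring_iso_def)
  then have h: "h (a + b) = h a + h b" "h 1 = 1" for a b
    by (auto simp: ring_hom_def ring_of_type_algebra_def)
  ultimately show False using h(1)[of 1 1] h(1)[of 0 0] by simp
qed

lemma real_or_complex_two_neq_zero: "(2 :: 'k::real_or_complex) \<noteq> 0"
  by (rule disjE[OF real_or_complex[where 'a = 'k]]) (erule two_neq_zero_of_ring_iso)+

lemma real_or_complex_half: "1 / 2 + 1 / 2 = (1 :: 'k::real_or_complex)"
proof -
  have "1 / 2 + 1 / 2 = (2 / 2 :: 'k)" by (simp only: add_divide_distrib[symmetric] one_add_one)
  then show ?thesis using real_or_complex_two_neq_zero[where 'k = 'k] by simp
qed

section \<open>Homomorphisms out of presented algebras\<close>

locale assoc_algebra_hom = A: assoc_algebra K A + B: assoc_algebra K B for K A B +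
  fixes f
  assumes ring_hom: "f \<in> ring_hom A B"
    and hom_smult: "\<lbrakk>c \<in> carrier K; a \<in> carrier A\<rbrakk> \<Longrightarrow> f (c \<odot>\<^bsub>A\<^esub> a) = c \<odot>\<^bsub>B\<^esub> f a"
begin

sublocale ring_hom_ring A B f
  by (rule ring_hom_ringI2[OF A.ring_axioms B.ring_axioms ring_hom])

lemma hom_minus: "\<lbrakk>a \<in> carrier A; b \<in> carrier A\<rbrakk> \<Longrightarrow> f (a \<ominus>\<^bsub>A\<^esub> b) = f a \<ominus>\<^bsub>B\<^esub> f b"
  by (simp add: a_minus_def)

lemma hom_finsum': "(\<And>i. i \<in> I \<Longrightarrow> g i \<in> carrier A) \<Longrightarrow>
    f (finsum A g I) = (\<Oplus>\<^bsub>B\<^esub>i\<in>I. f (g i))"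
  by (simp add: hom_finsum Pi_iff comp_def)

lemma hom_commutator:
  "\<lbrakk>a \<in> carrier A; b \<in> carrier A\<rbrakk> \<Longrightarrow> f (commutator A a b) = commutator B (f a) (f b)"
  by (simp add: commutator_def hom_minus)

end

lemma assoc_algebra_hom_comp:
  assumes "assoc_algebra_hom K A B f" "assoc_algebra_hom K B C g"
  shows "assoc_algebra_hom K A C (g \<circ> f)"
proof -
  interpret f: assoc_algebra_hom K A B f by fact
  interpret g: assoc_algebra_hom K B C g by fact
  show ?thesis
    by unfold_locales (simp_all add: ring_hom_trans[OF f.ring_hom g.ring_hom] f.hom_smult g.hom_smult)
qed

lemma assoc_algebra_hom_quotient:
  assumes "ideal I R" "assoc_algebra K R"
  shows "assoc_algebra_hom K R (quotient_algebra R I) ((+>\<^bsub>R\<^esub>) I)"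
proof -
  interpret ideal I R by fact
  interpret R: assoc_algebra K R by fact
  interpret Q: assoc_algebra K "quotient_algebra R I" by (rule assoc_algebra_quotient[OF assms])
  show ?thesis
  proof
    show "(+>\<^bsub>R\<^esub>) I \<in> ring_hom R (quotient_algebra R I)"
      using rcos_ring_hom by (simp add: ring_hom_def)
  qed (simp add: quotient_coset_smult[OF assms])
qed

lemma quotient_ideal_zero:
  assumes "ideal I R" "r \<in> I"
  shows "I +>\<^bsub>R\<^esub> r = \<zero>\<^bsub>quotient_algebra R I\<^esub>"
  using ring.a_rcos_zero[OF ideal.axioms(2) assms] assms(1) by (simp add: FactRing_def)

lemma assoc_algebra_hom_presented:
  assumes "rels \<subseteq> carrier (free_algebra Z)"
  shows "assoc_algebra_hom ring_of_type_algebra (free_algebra Z) (presented_algebra Z rels)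
    ((+>\<^bsub>free_algebra Z\<^esub>) (Idl\<^bsub>free_algebra Z\<^esub> rels))"
  unfolding presented_algebra_def
  by (rule assoc_algebra_hom_quotient[OF ideal_presented[OF assms] assoc_algebra_free_algebra])

lemma presented_relation:
  assumes "rels \<subseteq> carrier (free_algebra Z)" "r \<in> rels"
  shows "Idl\<^bsub>free_algebra Z\<^esub> rels +>\<^bsub>free_algebra Z\<^esub> r = \<zero>\<^bsub>presented_algebra Z rels\<^esub>"
proof -
  interpret assoc_algebra ring_of_type_algebra "free_algebra Z" by (rule assoc_algebra_free_algebra)
  show ?thesis
    unfolding presented_algebra_def
    by (rule quotient_ideal_zero[OF ideal_presented[OF assms(1)]]) (use genideal_self[OF assms(1)] assms(2) in blast)
qed

section \<open>Bilinearity and multiplication of pure tensors\<close>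

locale algebra_tensor = A: assoc_algebra ring_of_type_algebra A + B: assoc_algebra ring_of_type_algebra B
  for A :: "('k::field, 'a) module" and B :: "('k, 'b) module"
begin

abbreviation M :: "('k, 'a \<times> 'b \<Rightarrow>\<^sub>0 'k) module" where
  "M \<equiv> monoid_algebra (A \<times>\<times> B)"

abbreviation T where "T \<equiv> tensor_algebra_product A B"

abbreviation pure :: "'a \<Rightarrow> 'b \<Rightarrow> ('a \<times> 'b \<Rightarrow>\<^sub>0 'k) set" (infix "\<otimes>\<^sub>T" 75) where
  "pure \<equiv> pure_tensor A B"

lemma ideal: "ideal (tensor_ideal A B) M"
  by (rule ideal_tensor_ideal(1)[OF A.assoc_algebra_axioms B.assoc_algebra_axioms])

lemma monoid_AB: "monoid (A \<times>\<times> B)"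
  by (intro DirProd_monoid A.monoid_axioms B.monoid_axioms)

sublocale T: assoc_algebra ring_of_type_algebra T
  by (rule ideal_tensor_ideal(2)[OF A.assoc_algebra_axioms B.assoc_algebra_axioms])

sublocale quot: assoc_algebra_hom ring_of_type_algebra M T "(+>\<^bsub>M\<^esub>) (tensor_ideal A B)"
  unfolding tensor_algebra_product_def
  by (rule assoc_algebra_hom_quotient[OF ideal assoc_algebra_monoid_algebra[OF monoid_AB]])

lemma quot_relation:
  assumes "r \<in> bilinearity_relations A B"
  shows "tensor_ideal A B +>\<^bsub>M\<^esub> r = \<zero>\<^bsub>T\<^esub>"
proof -
  have "r \<in> tensor_ideal A B"
    unfolding tensor_ideal_def
    using quot.A.genideal_self[OF bilinearity_relations_closed[OF A.assoc_algebra_axioms B.assoc_algebra_axioms]] assms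
    by blast
  then show ?thesis
    unfolding tensor_algebra_product_def by (rule quotient_ideal_zero[OF ideal])
qed

lemma single_closed: "\<lbrakk>a \<in> carrier A; b \<in> carrier B\<rbrakk> \<Longrightarrow> Poly_Mapping.single (a, b) c \<in> carrier M"
  by simp

lemma quot_eq:
  assumes "r - s \<in> bilinearity_relations A B" "s \<in> carrier M"
  shows "tensor_ideal A B +>\<^bsub>M\<^esub> r = tensor_ideal A B +>\<^bsub>M\<^esub> s"
proof -
  have rs: "r - s \<in> carrier M"
    using bilinearity_relations_closed[OF A.assoc_algebra_axioms B.assoc_algebra_axioms] assms(1) by blast
  have "tensor_ideal A B +>\<^bsub>M\<^esub> ((r - s) \<oplus>\<^bsub>M\<^esub> s) = tensor_ideal A B +>\<^bsub>M\<^esub> s"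
    by (subst quot.hom_add[OF rs assms(2)])
      (simp only: quot_relation[OF assms(1)] T.l_zero[OF quot.hom_closed[OF assms(2)]])
  then show ?thesis by simp
qed

lemma pure_closed [simp]: "\<lbrakk>a \<in> carrier A; b \<in> carrier B\<rbrakk> \<Longrightarrow> a \<otimes>\<^sub>T b \<in> carrier T"
  unfolding pure_tensor_def by (rule quot.hom_closed[OF single_closed])

lemma pure_add_left:
  assumes "a \<in> carrier A" "a' \<in> carrier A" "b \<in> carrier B"
  shows "(a \<oplus>\<^bsub>A\<^esub> a') \<otimes>\<^sub>T b = a \<otimes>\<^sub>T b \<oplus>\<^bsub>T\<^esub> a' \<otimes>\<^sub>T b"
proof -
  let ?s = "\<lambda>a b. Poly_Mapping.single (a, b) (1 :: 'k)"
  note c = single_closed[OF assms(1,3), of 1] single_closed[OF assms(2,3), of 1]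
  have "?s (a \<oplus>\<^bsub>A\<^esub> a') b - (?s a b \<oplus>\<^bsub>M\<^esub> ?s a' b) \<in> bilinearity_relations A B"
    using assms unfolding bilinearity_relations_def by (auto simp: diff_diff_eq)
  from quot_eq[OF this quot.A.a_closed[OF c]] show ?thesis
    unfolding pure_tensor_def by (simp only: quot.hom_add[OF c])
qed

lemma pure_add_right:
  assumes "a \<in> carrier A" "b \<in> carrier B" "b' \<in> carrier B"
  shows "a \<otimes>\<^sub>T (b \<oplus>\<^bsub>B\<^esub> b') = a \<otimes>\<^sub>T b \<oplus>\<^bsub>T\<^esub> a \<otimes>\<^sub>T b'"
proof -
  let ?s = "\<lambda>a b. Poly_Mapping.single (a, b) (1 :: 'k)"
  note c = single_closed[OF assms(1,2), of 1] single_closed[OF assms(1,3), of 1]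
  have "?s a (b \<oplus>\<^bsub>B\<^esub> b') - (?s a b \<oplus>\<^bsub>M\<^esub> ?s a b') \<in> bilinearity_relations A B"
    using assms unfolding bilinearity_relations_def by (auto simp: diff_diff_eq)
  from quot_eq[OF this quot.A.a_closed[OF c]] show ?thesis
    unfolding pure_tensor_def by (simp only: quot.hom_add[OF c])
qed

text \<open>The bilinearity relations carry the scalar as the coefficient of a basis vector; this
  identifies the class of such a vector with a scalar multiple in the quotient.\<close>

lemma smult_pure:
  assumes "a \<in> carrier A" "b \<in> carrier B"
  shows "tensor_ideal A B +>\<^bsub>M\<^esub> Poly_Mapping.single (a, b) c = c \<odot>\<^bsub>T\<^esub> (a \<otimes>\<^sub>T b)"
proof -
  have "Poly_Mapping.single (a, b) c = c \<odot>\<^bsub>M\<^esub> Poly_Mapping.single (a, b) 1"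
    by (simp add: poly_mapping_eqI lookup_single when_def)
  then show ?thesis
    unfolding pure_tensor_def by (simp only: quot.hom_smult single_closed[OF assms] carrier_ring_of_type_algebra UNIV_I)
qed

lemma pure_smult_left:
  assumes "a \<in> carrier A" "b \<in> carrier B"
  shows "(c \<odot>\<^bsub>A\<^esub> a) \<otimes>\<^sub>T b = c \<odot>\<^bsub>T\<^esub> (a \<otimes>\<^sub>T b)"
  by (subst smult_pure[OF assms, symmetric], unfold pure_tensor_def,
      rule quot_eq[OF _ single_closed[OF assms]])
    (use assms in \<open>auto simp: bilinearity_relations_def\<close>)

lemma pure_smult_right:
  assumes "a \<in> carrier A" "b \<in> carrier B"
  shows "a \<otimes>\<^sub>T (c \<odot>\<^bsub>B\<^esub> b) = c \<odot>\<^bsub>T\<^esub> (a \<otimes>\<^sub>T b)"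
  by (subst smult_pure[OF assms, symmetric], unfold pure_tensor_def,
      rule quot_eq[OF _ single_closed[OF assms]])
    (use assms in \<open>auto simp: bilinearity_relations_def\<close>)

lemma pure_mult:
  assumes "a \<in> carrier A" "b \<in> carrier B" "a' \<in> carrier A" "b' \<in> carrier B"
  shows "(a \<otimes>\<^sub>T b) \<otimes>\<^bsub>T\<^esub> (a' \<otimes>\<^sub>T b') = (a \<otimes>\<^bsub>A\<^esub> a') \<otimes>\<^sub>T (b \<otimes>\<^bsub>B\<^esub> b')"
  unfolding pure_tensor_def quot.hom_mult[OF single_closed[OF assms(1,2)] single_closed[OF assms(3,4)], symmetric]
  by simp

lemma pure_one: "\<one>\<^bsub>A\<^esub> \<otimes>\<^sub>T \<one>\<^bsub>B\<^esub> = \<one>\<^bsub>T\<^esub>"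
  unfolding pure_tensor_def using quot.hom_one by simp

lemma left_hom: "assoc_algebra_hom ring_of_type_algebra A T (\<lambda>a. a \<otimes>\<^sub>T \<one>\<^bsub>B\<^esub>)"
  by unfold_locales
    (auto intro!: ring_hom_memI simp: pure_mult pure_add_left pure_one pure_smult_left)

lemma right_hom: "assoc_algebra_hom ring_of_type_algebra B T (\<lambda>b. \<one>\<^bsub>A\<^esub> \<otimes>\<^sub>T b)"
  by unfold_locales
    (auto intro!: ring_hom_memI simp: pure_mult pure_add_right pure_one pure_smult_right)

lemma left_right_commute:
  assumes "a \<in> carrier A" "b \<in> carrier B"
  shows "(a \<otimes>\<^sub>T \<one>\<^bsub>B\<^esub>) \<otimes>\<^bsub>T\<^esub> (\<one>\<^bsub>A\<^esub> \<otimes>\<^sub>T b) = (\<one>\<^bsub>A\<^esub> \<otimes>\<^sub>T b) \<otimes>\<^bsub>T\<^esub> (a \<otimes>\<^sub>T \<one>\<^bsub>B\<^esub>)"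
  using assms by (simp add: pure_mult)

end

section \<open>Relations between the generators in the tensor product\<close>

locale xpc =
  fixes N :: nat and \<epsilon> :: "'k::real_or_complex"
begin

abbreviation T where "T \<equiv> xpc_algebra N \<epsilon>"
abbreviation x where "x \<equiv> op_x N \<epsilon>"
abbreviation p where "p \<equiv> op_p N \<epsilon>"
abbreviation e where "e \<equiv> op_e N \<epsilon>"
abbreviation Fxp :: "('k, xp_gen list \<Rightarrow>\<^sub>0 'k) module" where "Fxp \<equiv> free_algebra (xp_gens N)"
abbreviation Fe :: "('k, nat list \<Rightarrow>\<^sub>0 'k) module" where "Fe \<equiv> free_algebra {1..N}"

sublocale T: assoc_algebra ring_of_type_algebra T
  by (rule assoc_algebra_xpc)

sublocale AC: algebra_tensor "xp_algebra N" "clifford_algebra N \<epsilon>"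
  unfolding xp_algebra_def clifford_algebra_def
  by (intro algebra_tensor.intro assoc_algebra_presented xp_relations_closed clifford_relations_closed)

text \<open>The composite from the free algebra through the presented algebra into the tensor
  product. Since it is a homomorphism on the free algebra, each defining relation is an element with
  image zero, from which the relation between the images of the generators is read off.\<close>

definition xp_hom where
  "xp_hom = (\<lambda>a. pure_tensor (xp_algebra N) (clifford_algebra N \<epsilon>) a \<one>\<^bsub>clifford_algebra N \<epsilon>\<^esub>) \<circ>
     (+>\<^bsub>Fxp\<^esub>) (Idl\<^bsub>Fxp\<^esub> xp_relations N)"

definition e_hom where
  "e_hom = pure_tensor (xp_algebra N) (clifford_algebra N \<epsilon>) \<one>\<^bsub>xp_algebra N\<^esub> \<circ>
     (+>\<^bsub>Fe\<^esub>) (Idl\<^bsub>Fe\<^esub> clifford_relations N \<epsilon>)"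

sublocale xp: assoc_algebra_hom ring_of_type_algebra Fxp T xp_hom
  unfolding xp_hom_def xpc_algebra_def
  by (rule assoc_algebra_hom_comp[OF _ AC.left_hom])
    (unfold xp_algebra_def, rule assoc_algebra_hom_presented[OF xp_relations_closed])

sublocale e: assoc_algebra_hom ring_of_type_algebra Fe T e_hom
  unfolding e_hom_def xpc_algebra_def
  by (rule assoc_algebra_hom_comp[OF _ AC.right_hom])
    (unfold clifford_algebra_def, rule assoc_algebra_hom_presented[OF clifford_relations_closed])

lemma xp_hom_e_hom_commute:
  assumes "a \<in> carrier Fxp" "b \<in> carrier Fe"
  shows "e_hom b \<otimes>\<^bsub>T\<^esub> xp_hom a = xp_hom a \<otimes>\<^bsub>T\<^esub> e_hom b"
proof -
  interpret a: assoc_algebra_hom ring_of_type_algebra Fxp "xp_algebra N" "(+>\<^bsub>Fxp\<^esub>) (Idl\<^bsub>Fxp\<^esub> xp_relations N)"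
    unfolding xp_algebra_def by (rule assoc_algebra_hom_presented[OF xp_relations_closed])
  interpret b: assoc_algebra_hom ring_of_type_algebra Fe "clifford_algebra N \<epsilon>" "(+>\<^bsub>Fe\<^esub>) (Idl\<^bsub>Fe\<^esub> clifford_relations N \<epsilon>)"
    unfolding clifford_algebra_def by (rule assoc_algebra_hom_presented[OF clifford_relations_closed])
  show ?thesis
    unfolding xp_hom_def e_hom_def comp_def xpc_algebra_def
    by (rule AC.left_right_commute[OF a.hom_closed[OF assms(1)] b.hom_closed[OF assms(2)], symmetric])
qed

lemma xp_hom_relation: "r \<in> xp_relations N \<Longrightarrow> xp_hom r = \<zero>\<^bsub>T\<^esub>"
proof -
  assume r: "r \<in> xp_relations N"
  interpret l: assoc_algebra_hom ring_of_type_algebra "xp_algebra N" AC.T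
      "\<lambda>a. pure_tensor (xp_algebra N) (clifford_algebra N \<epsilon>) a \<one>\<^bsub>clifford_algebra N \<epsilon>\<^esub>"
    by (rule AC.left_hom)
  show "xp_hom r = \<zero>\<^bsub>T\<^esub>"
    unfolding xp_hom_def comp_def xpc_algebra_def
      presented_relation[OF xp_relations_closed r, folded xp_algebra_def]
    by (rule l.hom_zero)
qed

lemma e_hom_relation: "r \<in> clifford_relations N \<epsilon> \<Longrightarrow> e_hom r = \<zero>\<^bsub>T\<^esub>"
proof -
  assume r: "r \<in> clifford_relations N \<epsilon>"
  interpret l: assoc_algebra_hom ring_of_type_algebra "clifford_algebra N \<epsilon>" AC.T
      "pure_tensor (xp_algebra N) (clifford_algebra N \<epsilon>) \<one>\<^bsub>xp_algebra N\<^esub>"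
    by (rule AC.right_hom)
  show "e_hom r = \<zero>\<^bsub>T\<^esub>"
    unfolding e_hom_def comp_def xpc_algebra_def
      presented_relation[OF clifford_relations_closed r, folded clifford_algebra_def]
    by (rule l.hom_zero)
qed

lemma gen_closed:
  assumes "i \<in> {1..N}"
  shows "free_gen (Gen_x i) \<in> carrier Fxp" "free_gen (Gen_p i) \<in> carrier Fxp" "free_gen i \<in> carrier Fe"
  using assms by (auto intro!: free_gen_closed simp: xp_gens_def)

lemma op_hom: "x i = xp_hom (free_gen (Gen_x i))" "p i = xp_hom (free_gen (Gen_p i))"
    "e i = e_hom (free_gen i)"
  by (simp_all add: op_x_def op_p_def op_e_def xp_hom_def e_hom_def presented_gen_def)

lemma op_closed [simp]:
  assumes "i \<in> {1..N}"
  shows "x i \<in> carrier T" "p i \<in> carrier T" "e i \<in> carrier T"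
  unfolding op_hom by (intro xp.hom_closed e.hom_closed gen_closed[OF assms])+

definition H where
  "H = (1 / 2) \<odot>\<^bsub>T\<^esub> (\<Oplus>\<^bsub>T\<^esub>i\<in>{1..N}. p i \<otimes>\<^bsub>T\<^esub> p i)"

lemma sum_pp_closed: "(\<Oplus>\<^bsub>T\<^esub>i\<in>{1..N}. p i \<otimes>\<^bsub>T\<^esub> p i) \<in> carrier T"
  by (intro T.finsum_closed) auto

lemma H_closed [simp]: "H \<in> carrier T"
  unfolding H_def by (intro T.smult_closed sum_pp_closed) simp

lemma H_add_H: "H \<oplus>\<^bsub>T\<^esub> H = (\<Oplus>\<^bsub>T\<^esub>i\<in>{1..N}. p i \<otimes>\<^bsub>T\<^esub> p i)"
proof -
  let ?s = "\<Oplus>\<^bsub>T\<^esub>i\<in>{1..N}. p i \<otimes>\<^bsub>T\<^esub> p i"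
  have "H \<oplus>\<^bsub>T\<^esub> H = (1 / 2 \<oplus>\<^bsub>ring_of_type_algebra\<^esub> 1 / 2) \<odot>\<^bsub>T\<^esub> ?s"
    unfolding H_def by (rule T.smult_l_distr[symmetric]) (simp_all add: sum_pp_closed)
  also have "1 / 2 \<oplus>\<^bsub>ring_of_type_algebra\<^esub> 1 / 2 = \<one>\<^bsub>ring_of_type_algebra :: 'k ring\<^esub>"
    by (simp add: ring_of_type_algebra_def real_or_complex_half)
  finally show ?thesis using T.smult_one[OF sum_pp_closed] by simp
qed

lemma commutator_zeroD:
  assumes "commutator T a b = \<zero>\<^bsub>T\<^esub>" "a \<in> carrier T" "b \<in> carrier T"
  shows "a \<otimes>\<^bsub>T\<^esub> b = b \<otimes>\<^bsub>T\<^esub> a"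
  using assms by (simp add: commutator_def T.r_right_minus_eq)

lemma x_comm: "\<lbrakk>i \<in> {1..N}; j \<in> {1..N}\<rbrakk> \<Longrightarrow> x i \<otimes>\<^bsub>T\<^esub> x j = x j \<otimes>\<^bsub>T\<^esub> x i"
  by (rule commutator_zeroD)
    (simp_all only: op_hom xp.hom_commutator[symmetric] gen_closed xp.hom_closed,
      rule xp_hom_relation, unfold xp_relations_def Let_def, blast)

lemma p_comm: "\<lbrakk>i \<in> {1..N}; j \<in> {1..N}\<rbrakk> \<Longrightarrow> p i \<otimes>\<^bsub>T\<^esub> p j = p j \<otimes>\<^bsub>T\<^esub> p i"
  by (rule commutator_zeroD)
    (simp_all only: op_hom xp.hom_commutator[symmetric] gen_closed xp.hom_closed,
      rule xp_hom_relation, unfold xp_relations_def Let_def, blast)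

lemma ex_comm: "\<lbrakk>i \<in> {1..N}; j \<in> {1..N}\<rbrakk> \<Longrightarrow> e i \<otimes>\<^bsub>T\<^esub> x j = x j \<otimes>\<^bsub>T\<^esub> e i"
  unfolding op_hom by (rule xp_hom_e_hom_commute) (rule gen_closed; assumption)+

lemma ep_comm: "\<lbrakk>i \<in> {1..N}; j \<in> {1..N}\<rbrakk> \<Longrightarrow> e i \<otimes>\<^bsub>T\<^esub> p j = p j \<otimes>\<^bsub>T\<^esub> e i"
  unfolding op_hom by (rule xp_hom_e_hom_commute) (rule gen_closed; assumption)+

lemma H_x:
  assumes j: "j \<in> {1..N}"
  shows "commutator T H (x j) = p j"
proof -
  let ?p = "\<lambda>i. free_gen (Gen_p i) :: xp_gen list \<Rightarrow>\<^sub>0 'k"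
  let ?h = "(1 / 2) \<odot>\<^bsub>Fxp\<^esub> (\<Oplus>\<^bsub>Fxp\<^esub>k\<in>{1..N}. ?p k \<otimes>\<^bsub>Fxp\<^esub> ?p k)"
  have s: "(\<Oplus>\<^bsub>Fxp\<^esub>k\<in>{1..N}. ?p k \<otimes>\<^bsub>Fxp\<^esub> ?p k) \<in> carrier Fxp"
    by (intro xp.A.finsum_closed Pi_I xp.A.m_closed gen_closed)
  then have h: "?h \<in> carrier Fxp" by (intro xp.A.smult_closed) simp_all
  have H: "xp_hom ?h = H"
  proof -
    have "xp_hom (\<Oplus>\<^bsub>Fxp\<^esub>k\<in>{1..N}. ?p k \<otimes>\<^bsub>Fxp\<^esub> ?p k) =
        (\<Oplus>\<^bsub>T\<^esub>k\<in>{1..N}. xp_hom (?p k \<otimes>\<^bsub>Fxp\<^esub> ?p k))"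
      by (rule xp.hom_finsum') (intro xp.A.m_closed gen_closed)
    also have "\<dots> = (\<Oplus>\<^bsub>T\<^esub>k\<in>{1..N}. p k \<otimes>\<^bsub>T\<^esub> p k)"
      by (rule T.finsum_cong') (auto simp: op_hom gen_closed simp del: atLeastAtMost_iff)
    finally show ?thesis
      unfolding H_def by (simp only: xp.hom_smult[OF _ s] carrier_ring_of_type_algebra UNIV_I)
  qed
  have c: "commutator Fxp ?h (free_gen (Gen_x j)) \<in> carrier Fxp"
    unfolding commutator_def by (intro xp.A.minus_closed xp.A.m_closed h gen_closed[OF j])
  have "commutator Fxp ?h (free_gen (Gen_x j)) \<ominus>\<^bsub>Fxp\<^esub> ?p j \<in> xp_relations N"
    using j unfolding xp_relations_def Let_def by blast
  from xp_hom_relation[OF this] have "commutator T H (x j) \<ominus>\<^bsub>T\<^esub> p j = \<zero>\<^bsub>T\<^esub>"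
    using gen_closed[OF j] h c by (simp only: xp.hom_minus xp.hom_commutator H op_hom)
  then show ?thesis
    using j by (simp add: commutator_def T.r_right_minus_eq)
qed

lemma e_relation:
  assumes ij: "i \<in> {1..N}" "j \<in> {1..N}"
  shows "e i \<otimes>\<^bsub>T\<^esub> e j \<oplus>\<^bsub>T\<^esub> e j \<otimes>\<^bsub>T\<^esub> e i = (2 * \<epsilon> * (if i = j then 1 else 0)) \<odot>\<^bsub>T\<^esub> \<one>\<^bsub>T\<^esub>"
proof -
  let ?e = "free_gen :: nat \<Rightarrow> nat list \<Rightarrow>\<^sub>0 'k" and ?c = "2 * \<epsilon> * (if i = j then 1 else 0)"
  note g = gen_closed(3)[OF ij(1)] gen_closed(3)[OF ij(2)]
  have "(?e i \<otimes>\<^bsub>Fe\<^esub> ?e j \<oplus>\<^bsub>Fe\<^esub> ?e j \<otimes>\<^bsub>Fe\<^esub> ?e i) \<ominus>\<^bsub>Fe\<^esub> ?c \<odot>\<^bsub>Fe\<^esub> \<one>\<^bsub>Fe\<^esub> \<in> clifford_relations N \<epsilon>"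
    using ij unfolding clifford_relations_def Let_def by blast
  from e_hom_relation[OF this]
  have "(e i \<otimes>\<^bsub>T\<^esub> e j \<oplus>\<^bsub>T\<^esub> e j \<otimes>\<^bsub>T\<^esub> e i) \<ominus>\<^bsub>T\<^esub> ?c \<odot>\<^bsub>T\<^esub> \<one>\<^bsub>T\<^esub> = \<zero>\<^bsub>T\<^esub>"
    using g by (simp only: e.hom_minus e.hom_add e.hom_mult e.hom_one e.hom_smult op_hom
        e.A.a_closed e.A.m_closed e.A.smult_closed e.A.one_closed carrier_ring_of_type_algebra UNIV_I)
  then show ?thesis
    using ij by (simp add: T.r_right_minus_eq T.smult_closed)
qed

lemma e_anticomm:
  assumes "i \<in> {1..N}" "j \<in> {1..N}" "i \<noteq> j"
  shows "e i \<otimes>\<^bsub>T\<^esub> e j = \<ominus>\<^bsub>T\<^esub> (e j \<otimes>\<^bsub>T\<^esub> e i)"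
proof -
  have "(0 :: 'k) \<odot>\<^bsub>T\<^esub> \<one>\<^bsub>T\<^esub> = \<zero>\<^bsub>T\<^esub>"
    using T.smult_l_null[OF T.one_closed] by (simp add: ring_of_type_algebra_def)
  then have "e i \<otimes>\<^bsub>T\<^esub> e j \<oplus>\<^bsub>T\<^esub> e j \<otimes>\<^bsub>T\<^esub> e i = \<zero>\<^bsub>T\<^esub>"
    using e_relation[OF assms(1,2)] assms(3) by simp
  then show ?thesis using assms by (simp add: T.minus_equality)
qed

text \<open>The Clifford relation at equal indices only determines twice the square, so it is
  halved.\<close>

lemma e_square:
  assumes "i \<in> {1..N}"
  shows "e i \<otimes>\<^bsub>T\<^esub> e i = \<epsilon> \<odot>\<^bsub>T\<^esub> \<one>\<^bsub>T\<^esub>"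
proof -
  let ?q = "e i \<otimes>\<^bsub>T\<^esub> e i"
  have q: "?q \<in> carrier T" using assms by simp
  have K: "a \<oplus>\<^bsub>ring_of_type_algebra\<^esub> b = a + b" "a \<otimes>\<^bsub>ring_of_type_algebra\<^esub> b = a * b"
    "\<one>\<^bsub>ring_of_type_algebra\<^esub> = 1" for a b :: 'k
    by (simp_all add: ring_of_type_algebra_def)
  have "(1 / 2) \<odot>\<^bsub>T\<^esub> (?q \<oplus>\<^bsub>T\<^esub> ?q) = (1 / 2) \<odot>\<^bsub>T\<^esub> ?q \<oplus>\<^bsub>T\<^esub> (1 / 2) \<odot>\<^bsub>T\<^esub> ?q"
    by (rule T.smult_r_distr) (simp_all add: q)
  also have "\<dots> = (1 / 2 + 1 / 2) \<odot>\<^bsub>T\<^esub> ?q"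
    unfolding K(1)[symmetric] by (rule T.smult_l_distr[symmetric]) (simp_all add: q)
  also have "\<dots> = ?q"
    unfolding real_or_complex_half using T.smult_one[OF q] by (simp add: K)
  finally have "?q = (1 / 2) \<odot>\<^bsub>T\<^esub> ((2 * \<epsilon>) \<odot>\<^bsub>T\<^esub> \<one>\<^bsub>T\<^esub>)"
    using e_relation[OF assms assms] by simp
  also have "\<dots> = (1 / 2 * (2 * \<epsilon>)) \<odot>\<^bsub>T\<^esub> \<one>\<^bsub>T\<^esub>"
    using T.smult_assoc1[of "1 / 2" "2 * \<epsilon>" "\<one>\<^bsub>T\<^esub>"] by (simp add: K)
  finally show ?thesis using real_or_complex_two_neq_zero[where 'k = 'k] by simp
qed

end

section \<open>The supercommutator identity\<close>

context xpc
begin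

abbreviation D where "D \<equiv> op_D N \<epsilon>"

lemma D_closed [simp]: "D \<in> carrier T"
  unfolding op_D_def by (intro T.finsum_closed Pi_I T.m_closed op_closed)

lemma x_set_closed: "S \<subseteq> {1..N} \<Longrightarrow> op_x_set N \<epsilon> S \<in> carrier T"
  unfolding op_x_set_def by (intro T.finsum_closed Pi_I T.m_closed op_closed) auto

lemma e_list_closed: "set L \<subseteq> {1..N} \<Longrightarrow> op_e_list N \<epsilon> L \<in> carrier T"
  unfolding op_e_list_def by (induction L) auto

lemma E_closed: "\<forall>L\<in>set As. set L \<subseteq> {1..N} \<Longrightarrow> op_E N \<epsilon> As \<in> carrier T"
  unfolding op_E_def by (induction As) (auto simp: e_list_closed)

lemma index_set_subset: "\<forall>L\<in>set As. set L \<subseteq> {1..N} \<Longrightarrow> index_set As \<subseteq> {1..N}"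
  unfolding index_set_def by (induction As) auto

definition dbl_op_O where
  "dbl_op_O As = D \<otimes>\<^bsub>T\<^esub> op_x_set N \<epsilon> (index_set As) \<otimes>\<^bsub>T\<^esub> op_E N \<epsilon> As
     \<ominus>\<^bsub>T\<^esub> op_E N \<epsilon> As \<otimes>\<^bsub>T\<^esub> op_x_set N \<epsilon> (index_set As) \<otimes>\<^bsub>T\<^esub> D
     \<ominus>\<^bsub>T\<^esub> \<epsilon> \<odot>\<^bsub>T\<^esub> op_E N \<epsilon> As"

lemma dbl_op_O_closed: "\<forall>L\<in>set As. set L \<subseteq> {1..N} \<Longrightarrow> dbl_op_O As \<in> carrier T"
  unfolding dbl_op_O_def
  by (intro T.minus_closed T.m_closed D_closed x_set_closed E_closed index_set_subset T.smult_closed)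
    simp_all

text \<open>Four times the supercommutator, a factor 2 for each operator. Its only scalars are eps
  and signs, which \<open>signed\<close> can express in a ring without scalar
  multiplication.\<close>

definition quad_supercommutator where
  "quad_supercommutator As Bs = dbl_op_O As \<otimes>\<^bsub>T\<^esub> dbl_op_O Bs \<ominus>\<^bsub>T\<^esub>
     ((-1) ^ (card (index_set As) * card (index_set Bs) - card (index_set As \<inter> index_set Bs)))
       \<odot>\<^bsub>T\<^esub> (dbl_op_O Bs \<otimes>\<^bsub>T\<^esub> dbl_op_O As)"

lemma quad_supercommutator_closed:
  "\<lbrakk>\<forall>L\<in>set As. set L \<subseteq> {1..N}; \<forall>L\<in>set Bs. set L \<subseteq> {1..N}\<rbrakk>
    \<Longrightarrow> quad_supercommutator As Bs \<in> carrier T"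
  unfolding quad_supercommutator_def by (intro T.minus_closed T.m_closed T.smult_closed dbl_op_O_closed) simp_all

lemma smult_minus:
  "\<lbrakk>a \<in> carrier T; b \<in> carrier T\<rbrakk> \<Longrightarrow> c \<odot>\<^bsub>T\<^esub> (a \<ominus>\<^bsub>T\<^esub> b) = c \<odot>\<^bsub>T\<^esub> a \<ominus>\<^bsub>T\<^esub> c \<odot>\<^bsub>T\<^esub> b"
  by (simp add: a_minus_def T.smult_r_distr T.smult_r_minus)

lemma smult_smult: "a \<in> carrier T \<Longrightarrow> c \<odot>\<^bsub>T\<^esub> (d \<odot>\<^bsub>T\<^esub> a) = (c * d) \<odot>\<^bsub>T\<^esub> a"
  using T.smult_assoc1[of c d a] by (simp add: ring_of_type_algebra_def)

lemma supercommutator_eq_quad_supercommutator: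
  assumes "\<forall>L\<in>set As. set L \<subseteq> {1..N}" "\<forall>L\<in>set Bs. set L \<subseteq> {1..N}"
  shows "supercommutator N \<epsilon> As Bs = (1 / 2 * (1 / 2)) \<odot>\<^bsub>T\<^esub> quad_supercommutator As Bs"
proof -
  note c = dbl_op_O_closed[OF assms(1)] dbl_op_O_closed[OF assms(2)]
  have O: "op_O N \<epsilon> Ls = (1 / 2) \<odot>\<^bsub>T\<^esub> dbl_op_O Ls" for Ls
    by (simp add: op_O_def dbl_op_O_def Let_def)
  have *: "((1 / 2) \<odot>\<^bsub>T\<^esub> a) \<otimes>\<^bsub>T\<^esub> ((1 / 2) \<odot>\<^bsub>T\<^esub> b) = (1 / 2 * (1 / 2)) \<odot>\<^bsub>T\<^esub> (a \<otimes>\<^bsub>T\<^esub> b)"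
    if "a \<in> carrier T" "b \<in> carrier T" for a b
    using that by (simp add: T.smult_mult_left T.smult_mult_right smult_smult del: times_divide_eq_left times_divide_eq_right)
  show ?thesis
    unfolding supercommutator_def quad_supercommutator_def Let_def O *[OF c] *[OF c(2,1)]
    using c by (simp add: smult_minus smult_smult mult.commute del: times_divide_eq_left times_divide_eq_right)
qed

section \<open>Transfer of the identity to \<open>ring_family\<close>\<close>

abbreviation \<iota> where "\<iota> \<equiv> T.embed"

context
  fixes k :: nat
  assumes eps: "\<epsilon> = (-1) ^ k"
begin

text \<open>Scalars have no counterpart in \<open>ring_family\<close>; the scalar -1 does, because a
  + (-1) a = 0 is preserved by the additive embedding.\<close>

lemma embed_sign: "a \<in> carrier T \<Longrightarrow> \<iota> (((-1) ^ n) \<odot>\<^bsub>T\<^esub> a) = signed n (\<iota> a)"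
proof -
  assume a: "a \<in> carrier T"
  have 1: "1 \<odot>\<^bsub>T\<^esub> a = a" using T.smult_one[OF a] by (simp add: ring_of_type_algebra_def)
  have "(0 :: 'k) \<odot>\<^bsub>T\<^esub> a = \<zero>\<^bsub>T\<^esub>"
    using T.smult_l_null[OF a] by (simp add: ring_of_type_algebra_def)
  moreover have "(1 + (- 1) :: 'k) \<odot>\<^bsub>T\<^esub> a = 1 \<odot>\<^bsub>T\<^esub> a \<oplus>\<^bsub>T\<^esub> (- 1) \<odot>\<^bsub>T\<^esub> a"
    using T.smult_l_distr[of 1 "- 1" a] a by (simp add: ring_of_type_algebra_def)
  ultimately have "a \<oplus>\<^bsub>T\<^esub> (- 1) \<odot>\<^bsub>T\<^esub> a = \<zero>\<^bsub>T\<^esub>" by (simp add: 1)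
  then have "\<iota> a + \<iota> ((- 1) \<odot>\<^bsub>T\<^esub> a) = 0"
    using a T.embed_add[of a "(- 1) \<odot>\<^bsub>T\<^esub> a"] by (simp add: T.embed_zero T.smult_closed)
  then show ?thesis
    by (cases "even n") (simp_all add: signed_def 1 eq_neg_iff_add_eq_0 add.commute)
qed

lemma embed_eps: "a \<in> carrier T \<Longrightarrow> \<iota> (\<epsilon> \<odot>\<^bsub>T\<^esub> a) = signed k (\<iota> a)"
  using embed_sign[of a k] by (simp only: eps[symmetric])

interpretation C: xp_clifford "\<lambda>i. \<iota> (x i)" "\<lambda>i. \<iota> (p i)" "\<lambda>i. \<iota> (e i)" "\<iota> H" "\<iota> \<one>\<^bsub>T\<^esub>" "{1..N}" k
proof
  show "finite {1..N}" by simp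
next
  fix i j assume ij: "i \<in> {1..N}" "j \<in> {1..N}"
  note m = T.embed_mult[symmetric] op_closed[OF ij(1)] op_closed[OF ij(2)]
  show "\<iota> (x i) * \<iota> (x j) = \<iota> (x j) * \<iota> (x i)" by (simp only: m x_comm[OF ij])
  show "\<iota> (p i) * \<iota> (p j) = \<iota> (p j) * \<iota> (p i)" by (simp only: m p_comm[OF ij])
  show "\<iota> (e i) * \<iota> (x j) = \<iota> (x j) * \<iota> (e i)" by (simp only: m ex_comm[OF ij])
  show "\<iota> (e i) * \<iota> (p j) = \<iota> (p j) * \<iota> (e i)" by (simp only: m ep_comm[OF ij])
  show "\<iota> (e i) * \<iota> (e j) = - (\<iota> (e j) * \<iota> (e i))" if "i \<noteq> j"
    by (simp only: m e_anticomm[OF ij that] T.embed_uminus T.m_closed)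
next
  fix i assume i: "i \<in> {1..N}"
  note m = T.embed_mult[symmetric] op_closed[OF i] T.one_closed
  show "\<iota> (e i) * \<iota> (e i) = signed k (\<iota> \<one>\<^bsub>T\<^esub>)"
    by (simp only: m e_square[OF i] embed_eps)
  show "\<iota> \<one>\<^bsub>T\<^esub> * \<iota> (x i) = \<iota> (x i)" "\<iota> (x i) * \<iota> \<one>\<^bsub>T\<^esub> = \<iota> (x i)"
    "\<iota> \<one>\<^bsub>T\<^esub> * \<iota> (p i) = \<iota> (p i)" "\<iota> (p i) * \<iota> \<one>\<^bsub>T\<^esub> = \<iota> (p i)"
    "\<iota> \<one>\<^bsub>T\<^esub> * \<iota> (e i) = \<iota> (e i)" "\<iota> (e i) * \<iota> \<one>\<^bsub>T\<^esub> = \<iota> (e i)"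
    by (simp_all only: m T.l_one T.r_one)
  show "\<iota> H * \<iota> (x i) - \<iota> (x i) * \<iota> H = \<iota> (p i)"
    unfolding H_x[OF i, symmetric] commutator_def
    by (simp only: T.embed_minus T.embed_mult T.m_closed H_closed op_closed[OF i])
next
  show "\<iota> \<one>\<^bsub>T\<^esub> * \<iota> \<one>\<^bsub>T\<^esub> = \<iota> \<one>\<^bsub>T\<^esub>"
    by (simp only: T.embed_mult[symmetric] T.one_closed T.l_one)
  have "\<iota> H + \<iota> H = (\<Sum>i\<in>{1..N}. \<iota> (p i \<otimes>\<^bsub>T\<^esub> p i))"
    unfolding T.embed_add[OF H_closed H_closed, symmetric] H_add_H
    by (rule T.embed_finsum) (simp_all del: atLeastAtMost_iff)
  also have "\<dots> = (\<Sum>i\<in>{1..N}. \<iota> (p i) * \<iota> (p i))"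
    by (intro sum.cong refl T.embed_mult op_closed)
  finally show "\<iota> H + \<iota> H = (\<Sum>i\<in>{1..N}. \<iota> (p i) * \<iota> (p i))" .
qed

lemma embed_D: "\<iota> D = C.D"
proof -
  have "\<iota> D = (\<Sum>i\<in>{1..N}. \<iota> (e i \<otimes>\<^bsub>T\<^esub> p i))"
    unfolding op_D_def by (rule T.embed_finsum) (simp_all del: atLeastAtMost_iff)
  also have "\<dots> = C.D"
    unfolding C.D_def by (intro sum.cong refl T.embed_mult op_closed)
  finally show ?thesis .
qed

lemma embed_x_set: "S \<subseteq> {1..N} \<Longrightarrow> \<iota> (op_x_set N \<epsilon> S) = C.x_vec S"
proof -
  assume S: "S \<subseteq> {1..N}"
  have "\<iota> (op_x_set N \<epsilon> S) = (\<Sum>i\<in>S. \<iota> (x i \<otimes>\<^bsub>T\<^esub> e i))"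
    unfolding op_x_set_def
    by (rule T.embed_finsum) (use S finite_subset[OF S] in \<open>auto intro!: T.m_closed op_closed\<close>)
  also have "\<dots> = C.x_vec S"
    unfolding C.x_vec_def by (intro sum.cong refl T.embed_mult op_closed) (use S in auto)
  finally show ?thesis .
qed

lemma embed_e_list: "set L \<subseteq> {1..N} \<Longrightarrow> \<iota> (op_e_list N \<epsilon> L) = C.elist L"
proof (induction L)
  case (Cons a L)
  then have "\<iota> (op_e_list N \<epsilon> (a # L)) = \<iota> (e a) * \<iota> (op_e_list N \<epsilon> L)"
    using e_list_closed[of L] T.embed_mult[of "e a" "op_e_list N \<epsilon> L"] by (simp add: op_e_list_def)
  with Cons show ?case by (simp add: C.elist_def)
qed (simp add: op_e_list_def C.elist_def)

lemma embed_E: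
  "\<forall>L\<in>set As. set L \<subseteq> {1..N} \<Longrightarrow>
    \<iota> (op_E N \<epsilon> As) = foldr (\<lambda>L v. C.elist L * v) As (\<iota> \<one>\<^bsub>T\<^esub>)"
proof (induction As)
  case (Cons L As)
  have L: "set L \<subseteq> {1..N}" and As: "\<forall>L\<in>set As. set L \<subseteq> {1..N}" using Cons.prems by simp_all
  have "\<iota> (op_E N \<epsilon> (L # As)) = \<iota> (op_e_list N \<epsilon> L) * \<iota> (op_E N \<epsilon> As)"
    using T.embed_mult[OF e_list_closed[OF L] E_closed[OF As]] by (simp add: op_E_def)
  with Cons L show ?case by (simp add: embed_e_list)
qed (simp add: op_E_def)

lemma embed_dbl_op_O:
  assumes "\<forall>L\<in>set As. set L \<subseteq> {1..N}"
  shows "\<iota> (dbl_op_O As) = C.dblO (index_set As) (\<iota> (op_E N \<epsilon> As))"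
  using E_closed[OF assms] x_set_closed[OF index_set_subset[OF assms]]
  unfolding dbl_op_O_def C.dblO_def embed_D[symmetric] embed_x_set[OF index_set_subset[OF assms], symmetric]
  by (simp add: T.embed_minus T.embed_mult embed_eps T.smult_closed)

text \<open>For disjoint index sets the exponent |S||T| - |S n T| of the supercommutator is the
  product of the cardinalities, as in \<open>superbr\<close>.\<close>

lemma embed_quad_supercommutator:
  assumes "\<forall>L\<in>set As. set L \<subseteq> {1..N}" "\<forall>L\<in>set Bs. set L \<subseteq> {1..N}"
    and "index_set As \<inter> index_set Bs = {}"
  shows "\<iota> (quad_supercommutator As Bs) = superbr (card (index_set As) * card (index_set Bs))
    (C.dblO (index_set As) (\<iota> (op_E N \<epsilon> As))) (C.dblO (index_set Bs) (\<iota> (op_E N \<epsilon> Bs)))"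
  using dbl_op_O_closed[OF assms(1)] dbl_op_O_closed[OF assms(2)]
  unfolding quad_supercommutator_def superbr_def embed_dbl_op_O[OF assms(1), symmetric] embed_dbl_op_O[OF assms(2), symmetric] assms(3)
  by (simp add: T.embed_minus T.embed_mult embed_sign T.smult_closed)

lemma quad_supercommutator_sum:
  assumes A: "distinct A" "set A \<subseteq> {1..N}" and B: "distinct B" "set B \<subseteq> {1..N}"
    and AB: "set A \<inter> set B = {}"
  shows "quad_supercommutator [A] [B] = \<epsilon> \<odot>\<^bsub>T\<^esub> (\<Oplus>\<^bsub>T\<^esub>a\<in>set A. quad_supercommutator [[a]] [[a], A, B])"
proof (rule T.embed_inject)
  have u: "C.elist L * \<iota> \<one>\<^bsub>T\<^esub> = C.elist L" if "set L \<subseteq> {1..N}" for L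
    using C.elist_u(2)[OF that] .
  have cl: "quad_supercommutator [[a]] [[a], A, B] \<in> carrier T" if "a \<in> set A" for a
    using that A B by (intro quad_supercommutator_closed) auto
  have sum_cl: "(\<Oplus>\<^bsub>T\<^esub>a\<in>set A. quad_supercommutator [[a]] [[a], A, B]) \<in> carrier T"
    by (intro T.finsum_closed Pi_I cl)
  show "quad_supercommutator [A] [B] \<in> carrier T" using A B by (intro quad_supercommutator_closed) auto
  show "\<epsilon> \<odot>\<^bsub>T\<^esub> (\<Oplus>\<^bsub>T\<^esub>a\<in>set A. quad_supercommutator [[a]] [[a], A, B]) \<in> carrier T"
    by (intro T.smult_closed sum_cl) simp
  have "\<iota> (quad_supercommutator [[a]] [[a], A, B]) = superbr (card (set A \<union> set B - {a})) (C.dblO {a} (C.elist [a]))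
      (C.dblO (set A \<union> set B - {a}) (C.elist [a] * (C.elist A * C.elist B)))"
    if a: "a \<in> set A" for a
  proof -
    \<comment> \<open>As \<open>a\<close> lies in \<open>A\<close> and \<open>A\<close>,
      \<open>B\<close> are disjoint, the symmetric difference of {a}, \<open>A\<close> and
      \<open>B\<close> is their union without \<open>a\<close>, hence disjoint from {a}.\<close>
    have i: "index_set [[a]] = {a}" "index_set [[a], A, B] = set A \<union> set B - {a}"
      using a AB by (auto simp: index_set_def)
    have aI: "set [a] \<subseteq> {1..N}" using a A by auto
    have s: "\<forall>L\<in>set [[a]]. set L \<subseteq> {1..N}" "\<forall>L\<in>set [[a], A, B]. set L \<subseteq> {1..N}"
      using aI A B by auto
    have E: "\<iota> (op_E N \<epsilon> [[a]]) = C.elist [a]"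
      "\<iota> (op_E N \<epsilon> [[a], A, B]) = C.elist [a] * (C.elist A * C.elist B)"
      by (simp_all only: embed_E[OF s(1)] embed_E[OF s(2)] foldr.simps comp_apply id_apply u[OF aI] u[OF B(2)])
    have "index_set [[a]] \<inter> index_set [[a], A, B] = {}" unfolding i by blast
    from embed_quad_supercommutator[OF s this] show ?thesis by (simp only: i E) simp
  qed
  then have "signed k (\<Sum>a\<in>set A. \<iota> (quad_supercommutator [[a]] [[a], A, B])) = signed k (\<Sum>a\<in>set A.
      superbr (card (set A \<union> set B - {a})) (C.dblO {a} (C.elist [a]))
      (C.dblO (set A \<union> set B - {a}) (C.elist [a] * (C.elist A * C.elist B))))"
    by simp
  also have "\<dots> = superbr (card (set A) * card (set B)) (C.dblO (set A) (C.elist A)) (C.dblO (set B) (C.elist B))"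
    by (rule C.supercommutator_sum[OF A B AB, symmetric])
  also have "\<dots> = \<iota> (quad_supercommutator [A] [B])"
  proof -
    have s: "\<forall>L\<in>set [A]. set L \<subseteq> {1..N}" "\<forall>L\<in>set [B]. set L \<subseteq> {1..N}"
      using A B by auto
    have i: "index_set [A] = set A" "index_set [B] = set B" by (auto simp: index_set_def)
    have E: "\<iota> (op_E N \<epsilon> [A]) = C.elist A" "\<iota> (op_E N \<epsilon> [B]) = C.elist B"
      by (simp_all only: embed_E[OF s(1)] embed_E[OF s(2)] foldr.simps comp_apply id_apply u[OF A(2)] u[OF B(2)])
    show ?thesis using embed_quad_supercommutator[OF s] AB unfolding i E by (simp only: simp_thms)
  qed
  finally show "\<iota> (quad_supercommutator [A] [B]) = \<iota> (\<epsilon> \<odot>\<^bsub>T\<^esub> (\<Oplus>\<^bsub>T\<^esub>a\<in>set A. quad_supercommutator [[a]] [[a], A, B]))"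
    by (simp add: embed_eps[OF sum_cl] T.embed_finsum cl)
qed

end

end

theorem theorem3p14:
  fixes N :: nat and \<epsilon> :: "'k::real_or_complex" and A B :: "nat list"
  assumes "N \<ge> 1"
    and "\<epsilon> = 1 \<or> \<epsilon> = -1"
    and "distinct A" and "set A \<subseteq> {1..N}"
    and "distinct B" and "set B \<subseteq> {1..N}"
    and "set A \<inter> set B = {}"
  shows "supercommutator N \<epsilon> [A] [B] =
    \<epsilon> \<odot>\<^bsub>xpc_algebra N \<epsilon>\<^esub>
      (\<Oplus>\<^bsub>xpc_algebra N \<epsilon>\<^esub>a\<in>set A. supercommutator N \<epsilon> [[a]] [[a], A, B])"
proof -
  interpret xpc N \<epsilon> .
  \<comment> \<open>The two halves of the operators in a supercommutator; the same constant arises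
    on both sides.\<close>
  let ?c = "1 / 2 * (1 / 2) :: 'k"
  \<comment> \<open>The exponent is 0 or 1.\<close>
  have "\<exists>k. \<epsilon> = (-1) ^ k" using assms(2) by (metis power_0 power_one_right)
  then obtain k where k: "\<epsilon> = (-1) ^ k" ..
  have cl: "quad_supercommutator [[a]] [[a], A, B] \<in> carrier T" if "a \<in> set A" for a
    using that assms by (intro quad_supercommutator_closed) auto
  then have sum_cl: "(\<Oplus>\<^bsub>T\<^esub>a\<in>set A. quad_supercommutator [[a]] [[a], A, B]) \<in> carrier T"
    by (intro T.finsum_closed Pi_I)
  have "supercommutator N \<epsilon> [A] [B] = ?c \<odot>\<^bsub>T\<^esub> quad_supercommutator [A] [B]"
    using assms by (intro supercommutator_eq_quad_supercommutator) auto
  also have "\<dots> = \<epsilon> \<odot>\<^bsub>T\<^esub> (?c \<odot>\<^bsub>T\<^esub> (\<Oplus>\<^bsub>T\<^esub>a\<in>set A. quad_supercommutator [[a]] [[a], A, B]))"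
    using quad_supercommutator_sum[OF k assms(3-7)] by (simp only: smult_smult[OF sum_cl] mult.commute)
  also have "?c \<odot>\<^bsub>T\<^esub> (\<Oplus>\<^bsub>T\<^esub>a\<in>set A. quad_supercommutator [[a]] [[a], A, B]) =
      (\<Oplus>\<^bsub>T\<^esub>a\<in>set A. ?c \<odot>\<^bsub>T\<^esub> quad_supercommutator [[a]] [[a], A, B])"
    using cl by (intro T.finsum_smult_ldistr) auto
  also have "\<dots> = (\<Oplus>\<^bsub>T\<^esub>a\<in>set A. supercommutator N \<epsilon> [[a]] [[a], A, B])"
  proof (rule T.finsum_cong')
    fix a assume a: "a \<in> set A"
    then show "?c \<odot>\<^bsub>T\<^esub> quad_supercommutator [[a]] [[a], A, B] = supercommutator N \<epsilon> [[a]] [[a], A, B]"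
      using assms by (intro supercommutator_eq_quad_supercommutator[symmetric]) auto
  next
    show "(\<lambda>a. supercommutator N \<epsilon> [[a]] [[a], A, B]) \<in> set A \<rightarrow> carrier T"
    proof
      fix a assume a: "a \<in> set A"
      then have "supercommutator N \<epsilon> [[a]] [[a], A, B] = ?c \<odot>\<^bsub>T\<^esub> quad_supercommutator [[a]] [[a], A, B]"
        using assms by (intro supercommutator_eq_quad_supercommutator) auto
      then show "supercommutator N \<epsilon> [[a]] [[a], A, B] \<in> carrier T"
        using cl[OF a] by (simp add: T.smult_closed)
    qed
  qed simp
  finally show ?thesis .
qed

end
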